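(* Let $\Gamma$ and $\Delta$ be sets of relations over $\{0,1\}$ (represented as in the context). If $\Delta$ is finite and $\Delta\subseteq\langle\Gamma\rangle_{\exists!}$, then $\mathrm{U\text{-}SAT}(\Delta)$ is polynomial-time many-one reducible to $\mathrm{U\text{-}SAT}(\Gamma)$.
   Context: A upp-definition of an $n$-ary relation $R$ over $\Gamma$ is a formula $R(x_1,\dots,x_n)\equiv\exists y_1,\dots,y_m\colon R_1(\mathbf{x}_1)\wedge\dots\wedge R_k(\mathbf{x}_k)$ with $R_j\in\Gamma\cup\{\mathrm{Eq}\}$ (equality relation), $\mathbf{x}_j$ tuples of variables among $x_1,\dots,x_n,y_1,\dots,y_m$, such that each $y_j$ is a function of the values of $x_1,\dots,x_n$ in every satisfying assignment of the conjunction; $\langle\Gamma\rangle_{\exists!}$ is the set of upp-definable relations. $\mathrm{U\text{-}SAT}(\Gamma)$: given variables $V$ and constraints $R(x_{i_1},\dots,x_{i_{\mathrm{ar}(R)}})$ with $R\in\Gamma$, decide whether exactly one assignment $V\to\{0,1\}$ satisfies all constraints. Representation: relations are lists of tuples; the elements of $\Gamma$ are recursively enumerable by arity, and there is a computable $g\colon\mathbb{N}\to\mathbb{N}$ such that for every $k$-ary relation $R$, $R\in\langle\Gamma\rangle_{\exists!}$ iff $R\in\langle\Gamma\cap\{\text{relations of arity}\le g(k)\}\rangle_{\exists!}$. *)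

theory Defs
  imports "HOL-Library.FuncSet" "HOL-Computational_Algebra.Polynomial"
begin

section \<open>Deterministic multi-tape Turing machines\<close>

text \<open>
  States and tape symbols are natural numbers below a bound fixed by the machine. State 0 is
  initial, state 1 is halting, symbol 0 is the blank. Tapes are infinite in both directions;
  the input is on the first tape, the output on the last one, both starting at cell 0.
\<close>

type_synonym word = "nat list"

datatype dir = Lft | Stay | Rgt

record tm =
  ntapes :: nat
  nstates :: nat
  nsyms :: nat
  delta :: "nat \<Rightarrow> nat list \<Rightarrow> nat \<times> nat list \<times> dir list"

definition wf_tm :: "tm \<Rightarrow> bool" where
  "wf_tm M \<longleftrightarrow> 1 \<le> ntapes M \<and> 2 \<le> nstates M \<and> 1 \<le> nsyms M \<and>
    (\<forall>q ss. q < nstates M \<and> length ss = ntapes M \<and> set ss \<subseteq> {..<nsyms M} \<longrightarrow>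
      (case delta M q ss of (q', ws, ds) \<Rightarrow>
        q' < nstates M \<and> length ws = ntapes M \<and> set ws \<subseteq> {..<nsyms M} \<and> length ds = ntapes M))"

type_synonym tape = "(int \<Rightarrow> nat) \<times> int"

type_synonym config = "nat \<times> tape list"

fun shift :: "dir \<Rightarrow> int" where
  "shift Lft = -1"
| "shift Stay = 0"
| "shift Rgt = 1"

definition act :: "tape \<Rightarrow> nat \<times> dir \<Rightarrow> tape" where
  "act t a = ((fst t)(snd t := fst a), snd t + shift (snd a))"

definition step :: "tm \<Rightarrow> config \<Rightarrow> config" where
  "step M c = (case c of (q, ts) \<Rightarrow>
    if q = 1 then c
    else (case delta M q (map (\<lambda>t. fst t (snd t)) ts) of
      (q', ws, ds) \<Rightarrow> (q', map2 act ts (zip ws ds))))"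

definition word_tape :: "word \<Rightarrow> int \<Rightarrow> nat" where
  "word_tape w i = (if 0 \<le> i \<and> i < int (length w) then w ! nat i else 0)"

definition init :: "tm \<Rightarrow> word \<Rightarrow> config" where
  "init M w = (0, (word_tape w, 0) # replicate (ntapes M - 1) (word_tape [], 0))"

text \<open>On input \<open>w\<close> the machine halts within \<open>t\<close> steps with output \<open>v\<close>.\<close>

definition computes_within :: "tm \<Rightarrow> word \<Rightarrow> word \<Rightarrow> nat \<Rightarrow> bool" where
  "computes_within M w v t \<longleftrightarrow>
    set w \<subseteq> {0<..<nsyms M} \<and> 0 \<notin> set v \<and>
    (case (step M ^^ t) (init M w) of (q, ts) \<Rightarrow> q = 1 \<and> fst (last ts) = word_tape v)"

definition computes :: "tm \<Rightarrow> word \<Rightarrow> word \<Rightarrow> bool" where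
  "computes M w v \<longleftrightarrow> (\<exists>t. computes_within M w v t)"

definition poly_time_on :: "word set \<Rightarrow> (word \<Rightarrow> word) \<Rightarrow> bool" where
  "poly_time_on I f \<longleftrightarrow> (\<exists>M (p :: nat poly). wf_tm M \<and>
    (\<forall>w\<in>I. computes_within M w (f w) (poly p (length w))))"


section \<open>Decision problems and many-one reductions\<close>

text \<open>
  A decision problem is given by its set of (encoded) instances and the subset of those
  for which the answer is yes.
\<close>

record problem =
  instances :: "word set"
  yes :: "word set"

definition poly_reducible :: "problem \<Rightarrow> problem \<Rightarrow> bool"  (infix "\<le>\<^sub>p" 50) where
  "A \<le>\<^sub>p B \<longleftrightarrow> (\<exists>f. poly_time_on (instances A) f \<and>
    (\<forall>w\<in>instances A. f w \<in> instances B \<and> (w \<in> yes A \<longleftrightarrow> f w \<in> yes B)))"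


section \<open>Boolean relations and upp-definitions\<close>

text \<open>The arity is recorded explicitly, since the empty relation does not determine it.\<close>

type_synonym brel = "nat \<times> bool list set"

abbreviation arity :: "brel \<Rightarrow> nat" where
  "arity \<equiv> fst"

definition is_brel :: "brel \<Rightarrow> bool" where
  "is_brel S \<longleftrightarrow> (\<forall>t\<in>snd S. length t = arity S)"

definition Eq_rel :: brel where
  "Eq_rel = (2, {[a, a] |a. True})"

text \<open>
  In a formula defining an \<open>n\<close>-ary relation, the variables \<open>x\<^sub>1, \<dots>, x\<^sub>n\<close> are the
  numbers \<open>0, \<dots>, n - 1\<close>, and \<open>y\<^sub>1, \<dots>, y\<^sub>m\<close> are \<open>n, \<dots>, n + m - 1\<close>.
\<close>

type_synonym atom = "brel \<times> nat list"

definition sat :: "(nat \<Rightarrow> bool) \<Rightarrow> atom list \<Rightarrow> bool" where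
  "sat s \<phi> \<longleftrightarrow> (\<forall>(S, is)\<in>set \<phi>. map s is \<in> snd S)"

definition upp_definition :: "brel set \<Rightarrow> brel \<Rightarrow> nat \<Rightarrow> atom list \<Rightarrow> bool" where
  "upp_definition \<Gamma> R m \<phi> \<longleftrightarrow> (let n = arity R in
    (\<forall>(S, is)\<in>set \<phi>. S \<in> \<Gamma> \<union> {Eq_rel} \<and> length is = arity S \<and> set is \<subseteq> {..<n + m}) \<and>
    snd R = {map s [0..<n] |s. sat s \<phi>} \<and>
    (\<forall>j<m. \<exists>f :: bool list \<Rightarrow> bool. \<forall>s. sat s \<phi> \<longrightarrow> s (n + j) = f (map s [0..<n])))"

definition upp_closure :: "brel set \<Rightarrow> brel set" where
  "upp_closure \<Gamma> = {R. \<exists>m \<phi>. upp_definition \<Gamma> R m \<phi>}"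


section \<open>The problem U-SAT\<close>

text \<open>
  Variables are named by binary strings. An instance consists of a list of the variables and
  a list of constraints, where a constraint is a relation, given as a list of its tuples,
  together with a tuple of variables.
\<close>

type_synonym var = "bool list"

type_synonym constraint = "bool list list \<times> var list"

type_synonym inst = "var list \<times> constraint list"

definition is_instance :: "brel set \<Rightarrow> inst \<Rightarrow> bool" where
  "is_instance \<Gamma> I \<longleftrightarrow> (\<forall>(ts, xs)\<in>set (snd I).
    distinct ts \<and> (length xs, set ts) \<in> \<Gamma> \<and> set xs \<subseteq> set (fst I))"

definition uniquely_satisfiable :: "inst \<Rightarrow> bool" where
  "uniquely_satisfiable I \<longleftrightarrow> (\<exists>!\<sigma>. \<sigma> \<in> (set (fst I) \<rightarrow>\<^sub>E (UNIV :: bool set)) \<and>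
    (\<forall>(ts, xs)\<in>set (snd I). map \<sigma> xs \<in> set ts))"

text \<open>Encoding: symbols 1 and 2 are the bits, 3, 4 and 5 are delimiters.\<close>

definition enc_bits :: "bool list \<Rightarrow> word" where
  "enc_bits bs = map (\<lambda>b. if b then 2 else 1) bs"

definition enc_list :: "bool list list \<Rightarrow> word" where
  "enc_list xs = concat (map (\<lambda>x. enc_bits x @ [3]) xs)"

definition enc_constraint :: "constraint \<Rightarrow> word" where
  "enc_constraint c = enc_list (fst c) @ [4] @ enc_list (snd c) @ [5]"

definition enc_inst :: "inst \<Rightarrow> word" where
  "enc_inst I = enc_list (fst I) @ [5] @ concat (map enc_constraint (snd I))"

definition USAT :: "brel set \<Rightarrow> problem" where
  "USAT \<Gamma> = \<lparr> instances = enc_inst ` {I. is_instance \<Gamma> I},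
               yes = enc_inst ` {I. is_instance \<Gamma> I \<and> uniquely_satisfiable I} \<rparr>"


section \<open>Representation of sets of relations\<close>

definition unary :: "nat \<Rightarrow> word" where
  "unary k = replicate k 1"

definition computable_nat :: "(nat \<Rightarrow> nat) \<Rightarrow> bool" where
  "computable_nat g \<longleftrightarrow> (\<exists>M. wf_tm M \<and> (\<forall>k. computes M (unary k) (unary (g k))))"

text \<open>
  Some machine enumerates, uniformly in \<open>k\<close>, the \<open>k\<close>-ary elements of \<open>\<Gamma>\<close> as lists of tuples:
  \<open>e k i\<close> is its \<open>i\<close>-th output for arity \<open>k\<close>. Outputs that do not encode a list of tuples
  are ignored, so there may be no element of arity \<open>k\<close>.
\<close>

definition enumerable_by_arity :: "brel set \<Rightarrow> bool" where
  "enumerable_by_arity \<Gamma> \<longleftrightarrow> (\<exists>M e. wf_tm M \<and>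
    (\<forall>k i. computes M (unary k @ [3] @ unary i) (e k i)) \<and>
    (\<forall>k T. (k, T) \<in> \<Gamma> \<longleftrightarrow> (\<exists>i ts. e k i = enc_list ts \<and> distinct ts \<and> set ts = T)))"

definition computable_arity_bound :: "brel set \<Rightarrow> bool" where
  "computable_arity_bound \<Gamma> \<longleftrightarrow> (\<exists>g. computable_nat g \<and>
    (\<forall>R. is_brel R \<longrightarrow>
      (R \<in> upp_closure \<Gamma> \<longleftrightarrow> R \<in> upp_closure (\<Gamma> \<inter> {S. arity S \<le> g (arity R)}))))"

definition represented :: "brel set \<Rightarrow> bool" where
  "represented \<Gamma> \<longleftrightarrow> enumerable_by_arity \<Gamma> \<and> computable_arity_bound \<Gamma>"

end

theory Submission imports Defs begin

text \<open>
  Each constraint is replaced by a upp-definition of its relation with fresh existential variables;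
  as their values are determined by the old variables, solutions correspond one to one. The
  equality constraints, which need not be available in \<open>\<Gamma>\<close>, are removed one at a time by replacing one
  variable by the other throughout.
  
  Only finitely many relation codes can occur in an instance over \<open>\<Delta>\<close>, so a finite control can look up
  the definitions. To obtain a Turing machine, the reduction is written in a small language of
  programs over stacks, in which a loop consumes one stack. If no stack exceeds length \<open>L\<close>, such
  a program runs in time polynomial in \<open>L\<close>. The substitutions never lengthen a name beyond the
  longest name present, hence all stacks stay of quadratic length.
\<close>

section \<open>Stack programs\<close>

text \<open>Correctness and running time must be shown for a concrete machine, and a separate step
  count would repeat the correctness proof. Loops may therefore only consume a stack: the number of
  rounds is fixed at entry, so length bounds at loop entries, carried inside the weakest
  precondition, already give the polynomial.

  Identifications can chain through many constraints, and a substitution also affects the equations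
  still to be treated. Hence pending equations, variables and constraints lie in one token stream
  that is rewritten as a whole. Two properties of the resulting renaming matter: both sides of each
  equation get the same name, so that every new solution satisfies the equality atoms; and no
  solution of the equations separates a name from its new name, so that every old solution passes to
  the renamed variables. Repeated entries in the renamed list of variables do no harm, since
  assignments are functions on its set.\<close>

text \<open>
  A register holds a word, used as a stack. \<open>For r f\<close> pops the symbols of register \<open>r\<close> one after the
  other and runs \<open>f a\<close> for each; \<open>Case r f\<close> branches on the topmost symbol, which is \<open>0\<close> if the
  stack is empty.
\<close>

datatype com =
    Skip
  | Push nat nat
  | Pop nat
  | Seq com com (infixr ";;" 60)
  | Case nat "nat \<Rightarrow> com"
  | For nat "nat \<Rightarrow> com"

type_synonym store = "nat \<Rightarrow> nat list"

definition top_of :: "nat list \<Rightarrow> nat" where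
  "top_of xs = (case xs of [] \<Rightarrow> 0 | x # _ \<Rightarrow> x)"

lemma top_of_simps [simp]: "top_of [] = 0" "top_of (x # xs) = x"
  by (simp_all add: top_of_def)

text \<open>The loop register may hold a rest \<open>ys\<close> below the part \<open>xs\<close> to
  be consumed. This allows a loop to be cut at the border between two segments of its input.\<close>

primrec iter :: "nat \<Rightarrow> (nat \<Rightarrow> (store \<Rightarrow> bool) \<Rightarrow> store \<Rightarrow> bool) \<Rightarrow> nat list \<Rightarrow> nat list \<Rightarrow>
    (store \<Rightarrow> bool) \<Rightarrow> store \<Rightarrow> bool" where
  "iter r F [] ys Q s = Q s"
| "iter r F (x # xs) ys Q s =
    F x (\<lambda>s'. s' r = xs @ ys \<and> iter r F xs ys Q s') (s(r := xs @ ys))"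

text \<open>
  Weakest preconditions for \<open>k\<close> registers over the symbols below \<open>B\<close>. The bound \<open>L\<close> on the length of every
  register at the start of a loop over it, together with the requirement that a loop body does not
  touch the loop register, is all that is needed for a running time polynomial in \<open>L\<close>.
\<close>

primrec wp :: "nat \<Rightarrow> nat \<Rightarrow> nat \<Rightarrow> com \<Rightarrow> (store \<Rightarrow> bool) \<Rightarrow> store \<Rightarrow> bool" where
  "wp k B L Skip = (\<lambda>Q. Q)"
| "wp k B L (Push r a) = (\<lambda>Q s. r < k \<and> 0 < a \<and> a < B \<and> Q (s(r := a # s r)))"
| "wp k B L (Pop r) = (\<lambda>Q s. r < k \<and> Q (s(r := tl (s r))))"
| "wp k B L (c ;; d) = (\<lambda>Q. wp k B L c (wp k B L d Q))"
| "wp k B L (Case r f) = (\<lambda>Q s. r < k \<and> (top_of (s r) < B \<longrightarrow> wp k B L (f (top_of (s r))) Q s))"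
| "wp k B L (For r f) = (\<lambda>Q s. r < k \<and> length (s r) \<le> L \<and>
    iter r (\<lambda>a Q s. 0 < a \<and> a < B \<longrightarrow> wp k B L (f a) Q s) (s r) [] Q s)"

text \<open>
  The continuations that can occur while \<open>c\<close> is run and then \<open>K\<close>; these finitely many lists are the
  control states of the Turing machine.
\<close>

primrec conts :: "nat \<Rightarrow> com \<Rightarrow> com list \<Rightarrow> com list set" where
  "conts B Skip = (\<lambda>K. {Skip # K})"
| "conts B (Push r a) = (\<lambda>K. {Push r a # K})"
| "conts B (Pop r) = (\<lambda>K. {Pop r # K})"
| "conts B (c ;; d) = (\<lambda>K. insert ((c ;; d) # K) (conts B c (d # K) \<union> conts B d K))"
| "conts B (Case r f) = (\<lambda>K. insert (Case r f # K) (\<Union>a<B. conts B (f a) K))"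
| "conts B (For r f) = (\<lambda>K. insert (For r f # K) (\<Union>a<B. conts B (f a) (For r f # K)))"

text \<open>The indeterminate \<open>[:0, 1:]\<close> stands for the length bound \<open>L\<close>.
  Branches are summed instead of maximised to stay within polynomials. \<open>Push\<close> costs two
  steps, since the head moves in one and writes in the next.\<close>

primrec run_time :: "nat \<Rightarrow> com \<Rightarrow> nat poly" where
  "run_time B Skip = 1"
| "run_time B (Push r a) = 2"
| "run_time B (Pop r) = 1"
| "run_time B (c ;; d) = 1 + run_time B c + run_time B d"
| "run_time B (Case r f) = 1 + (\<Sum>a<B. run_time B (f a))"
| "run_time B (For r f) = 1 + [:0, 1:] * (1 + (\<Sum>a<B. run_time B (f a)))"

lemma finite_conts: "finite (conts B c K)"
  by (induction c arbitrary: K) auto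

lemma conts_self: "c # K \<in> conts B c K"
  by (cases c) auto

section \<open>Stacks on tapes and the transition table\<close>

text \<open>
  The stack of register 0 grows to the left, with bottom at cell \<open>n - 1\<close>, so that initially it is the
  input of length \<open>n\<close>. The other stacks grow to the right from cell 0, with the head at cell \<open>-1\<close> when
  empty, so that the last tape finally carries the output, which is the reversed stack.
\<close>

definition fwd :: "nat \<Rightarrow> dir" where
  "fwd r = (if r = 0 then Lft else Rgt)"

definition bwd :: "nat \<Rightarrow> dir" where
  "bwd r = (if r = 0 then Rgt else Lft)"

definition stack_tape :: "nat \<Rightarrow> nat \<Rightarrow> nat list \<Rightarrow> tape" where
  "stack_tape n r xs = (if r = 0
    then (\<lambda>i. word_tape (rev xs) (int n - i - 1), int n - int (length xs))
    else (word_tape (rev xs), int (length xs) - 1))"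

definition grown_tape :: "nat \<Rightarrow> nat \<Rightarrow> nat list \<Rightarrow> tape" where
  "grown_tape n r xs =
    (fst (stack_tape n r xs), snd (stack_tape n r xs) + shift (fwd r))"

lemma word_tape_rev_top: "word_tape (rev xs) (int (length xs) - 1) = top_of xs"
  by (cases xs) (auto simp: word_tape_def nth_append nat_diff_distrib)

lemma stack_tape_top: "fst (stack_tape n r xs) (snd (stack_tape n r xs)) = top_of xs"
  by (auto simp: stack_tape_def word_tape_rev_top)

lemma word_tape_snoc: "word_tape (w @ [a]) = (word_tape w)(int (length w) := a)"
  by (auto simp: word_tape_def nth_append fun_eq_iff nat_less_iff)

lemma act_keep: "act t (fst t (snd t), Stay) = t"
  by (simp add: act_def)

lemma word_tape_after: "word_tape w (int (length w)) = 0"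
  by (simp add: word_tape_def)

text \<open>Overwriting the top by a blank yields the tape of the shorter word, because
  \<open>word_tape\<close> is 0 beyond the end of its word.\<close>

lemma act_pop: "act (stack_tape n r (x # xs)) (0, bwd r) = stack_tape n r xs"
  by (auto simp: act_def stack_tape_def bwd_def word_tape_snoc fun_eq_iff word_tape_after)
    (metis length_rev word_tape_after)+

lemma act_grow: "act (stack_tape n r xs) (top_of xs, fwd r) = grown_tape n r xs"
  unfolding grown_tape_def act_def by (simp flip: stack_tape_top[of n r])

lemma act_push: "act (grown_tape n r xs) (a, Stay) = stack_tape n r (a # xs)"
  by (auto simp: act_def grown_tape_def stack_tape_def fwd_def word_tape_snoc fun_eq_iff)

definition tapes :: "nat \<Rightarrow> nat \<Rightarrow> store \<Rightarrow> tape list" where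
  "tapes k n s = map (\<lambda>r. stack_tape n r (s r)) [0..<k]"

definition tops :: "nat \<Rightarrow> store \<Rightarrow> nat list" where
  "tops k s = map (\<lambda>r. top_of (s r)) [0..<k]"

text \<open>
  The flag marks the second half of a push, when the head has already moved to the new cell.
\<close>

fun transition :: "nat \<Rightarrow> nat \<Rightarrow> bool \<times> com list \<Rightarrow> nat list \<Rightarrow> (bool \<times> com list) \<times> nat list \<times> dir list" where
  "transition k B (b, []) ss = ((False, []), ss, replicate k Stay)"
| "transition k B (b, Skip # K) ss = ((False, K), ss, replicate k Stay)"
| "transition k B (False, Push r a # K) ss = ((True, Push r a # K), ss, (replicate k Stay)[r := fwd r])"
| "transition k B (True, Push r a # K) ss =
    ((False, K), ss[r := (if a < B then a else 0)], (replicate k Stay)[r := Stay])"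
| "transition k B (b, Pop r # K) ss = ((False, K),
    if ss ! r = 0 then (ss, replicate k Stay) else (ss[r := 0], (replicate k Stay)[r := bwd r]))"
| "transition k B (b, (c ;; d) # K) ss = ((False, c # d # K), ss, replicate k Stay)"
| "transition k B (b, Case r f # K) ss = ((False, f (ss ! r) # K), ss, replicate k Stay)"
| "transition k B (b, For r f # K) ss =
    (if ss ! r = 0 then ((False, K), ss, replicate k Stay)
     else ((False, f (ss ! r) # For r f # K), ss[r := 0], (replicate k Stay)[r := bwd r]))"

text \<open>State 0 is spent on one initial step that moves every head except the first to cell -1,
  the position for an empty stack. \<open>h\<close> numbers the pairs of flag and continuation;
  successors outside \<open>S\<close> are sent to the halting state to make the table total.\<close>

definition compile :: "nat \<Rightarrow> nat \<Rightarrow> com \<Rightarrow> com list set \<Rightarrow> (bool \<times> com list \<Rightarrow> nat) \<Rightarrow> nat \<Rightarrow> tm" where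
  "compile k B c S h N = \<lparr> ntapes = k, nstates = N, nsyms = B,
    delta = (\<lambda>q ss. if q = 0 then (h (False, [c]), ss, Stay # replicate (k - 1) Lft)
      else case transition k B (inv_into (UNIV \<times> S) h q) ss of (x, ws, ds) \<Rightarrow>
        (if x \<in> UNIV \<times> S then h x else 1, ws, ds)) \<rparr>"

text \<open>This has to hold for every command, whatever symbols it mentions, which is why
  \<open>transition\<close> writes 0 in place of a symbol outside the alphabet.\<close>

lemma transition_wf:
  assumes "length ss = k" "set ss \<subseteq> {..<B}" "0 < B" "transition k B x ss = (y, ws, ds)"
  shows "length ws = k \<and> set ws \<subseteq> {..<B} \<and> length ds = k"
  using assms
  by (induction k B x ss rule: transition.induct)
    (auto split: if_splits dest!: set_update_subset_insert[THEN subsetD] simp: subset_iff)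

lemma stack_tape_keep: "act (stack_tape n r xs) (top_of xs, Stay) = stack_tape n r xs"
  by (metis act_keep stack_tape_top)

lemma map2_act_keep:
  "map2 act (tapes k n s) (zip (tops k s) (replicate k Stay)) = tapes k n s"
  by (rule nth_equalityI) (auto simp: tapes_def tops_def stack_tape_keep)

lemma map2_act_update:
  assumes "length ts = k" "length ss = k" "length ds = k" "r < k"
  shows "map2 act ts (zip (ss[r := a]) (ds[r := d])) = (map2 act ts (zip ss ds))[r := act (ts ! r) (a, d)]"
  using assms by (intro nth_equalityI) (auto simp: nth_list_update)

lemma tapes_update: "r < k \<Longrightarrow> (tapes k n s)[r := stack_tape n r xs] = tapes k n (s(r := xs))"
  by (rule nth_equalityI) (auto simp: tapes_def nth_list_update)

lemma length_tapes [simp]: "length (tapes k n s) = k" "length (tops k s) = k"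
  by (simp_all add: tapes_def tops_def)

lemma nth_tapes [simp]:
  "r < k \<Longrightarrow> tapes k n s ! r = stack_tape n r (s r)" "r < k \<Longrightarrow> tops k s ! r = top_of (s r)"
  by (simp_all add: tapes_def tops_def)

lemma read_tapes: "map (\<lambda>t. fst t (snd t)) (tapes k n s) = tops k s"
  by (simp add: tapes_def tops_def stack_tape_top)

text \<open>Excluding 0 makes a blank under the head equivalent to an empty stack.\<close>

definition good :: "nat \<Rightarrow> nat \<Rightarrow> store \<Rightarrow> bool" where
  "good k B s \<longleftrightarrow> (\<forall>r<k. set (s r) \<subseteq> {0<..<B})"

lemma poly_sum_ge: "a < (B :: nat) \<Longrightarrow> poly (p a) x \<le> poly (\<Sum>a<B. p a) (x :: nat)"
  by (simp add: poly_sum member_le_sum[where f = "\<lambda>a. poly (p a) x"])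

section \<open>Simulation of stack programs by Turing machines\<close>

locale compiled =
  fixes k B :: nat and c0 :: com and S :: "com list set" and h :: "bool \<times> com list \<Rightarrow> nat" and N :: nat
  assumes k: "1 \<le> k" and B: "1 \<le> B"
    and inj_h: "inj_on h (UNIV \<times> S)"
    and h_halt: "h (False, []) = 1"
    and h_range: "h ` (UNIV \<times> S) \<subseteq> {1..<N}"
    and S_nil: "[] \<in> S"
    and S_conts: "conts B c0 [] \<subseteq> S"
begin

abbreviation "M \<equiv> compile k B c0 S h N"

lemma M_sel: "ntapes M = k" "nstates M = N" "nsyms M = B"
  by (simp_all add: compile_def)

lemma delta_M: "delta M q ss = (if q = 0 then (h (False, [c0]), ss, Stay # replicate (k - 1) Lft)
    else case transition k B (inv_into (UNIV \<times> S) h q) ss of (x, ws, ds) \<Rightarrow>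
      (if x \<in> UNIV \<times> S then h x else 1, ws, ds))"
  by (simp add: compile_def)

lemma wf: "wf_tm M"
proof -
  have h: "h x < N" if "snd x \<in> S" for x
    using h_range that by (cases x) (simp add: image_subset_iff)
  have N: "2 \<le> N"
    using h[of "(False, [])"] S_nil h_halt by simp
  have c0: "h (False, [c0]) < N"
    using S_conts conts_self[of c0 "[]" B] by (intro h) auto
  have "q' < N \<and> length ws = k \<and> set ws \<subseteq> {..<B} \<and> length ds = k"
    if "length ss = k" "set ss \<subseteq> {..<B}" "delta M q ss = (q', ws, ds)" for q ss q' ws ds
  proof (cases "q = 0")
    case True
    then show ?thesis
      using that c0 k by (simp add: delta_M) force
  next
    case False
    obtain x ws1 ds1 where x: "transition k B (inv_into (UNIV \<times> S) h q) ss = (x, ws1, ds1)"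
      by (rule prod_cases3)
    then have eq: "q' = (if x \<in> UNIV \<times> S then h x else 1)" "ws = ws1" "ds = ds1"
      using that(3) False by (simp_all add: delta_M)
    have "q' < N"
      unfolding eq using N h[of x] by (simp add: mem_Times_iff)
    then show ?thesis
      using transition_wf[OF that(1,2) _ x] B eq by simp
  qed
  then show ?thesis
    unfolding wf_tm_def M_sel using k B N by (simp split: prod.split) blast
qed

lemma step_M:
  assumes "K \<in> S" "(b, K) \<noteq> (False, [])"
    and "transition k B (b, K) (map (\<lambda>t. fst t (snd t)) ts) = ((b', K'), ws, ds)" "K' \<in> S"
  shows "step M (h (b, K), ts) = (h (b', K'), map2 act ts (zip ws ds))"
proof -
  have ne: "h (b, K) \<noteq> 1"
    using inj_onD[OF inj_h, of "(b, K)" "(False, [])"] assms(1,2) S_nil h_halt by auto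
  have "h (b, K) \<noteq> 0"
    using h_range assms(1) by (auto simp: image_subset_iff dest!: spec[of _ b] bspec[of _ _ K])
  moreover have "inv_into (UNIV \<times> S) h (h (b, K)) = (b, K)"
    using inj_h assms(1) by (simp add: inv_into_f_f)
  ultimately show ?thesis
    using ne assms unfolding step_def by (simp add: delta_M)
qed

text \<open>Compares configurations between commands only, where the flag is \<open>False\<close>.
  The input length \<open>n\<close> fixes the bottom cell of register 0.\<close>

definition reaches :: "nat \<Rightarrow> nat \<Rightarrow> com list \<Rightarrow> store \<Rightarrow> com list \<Rightarrow> store \<Rightarrow> bool" where
  "reaches n t K s K' s' \<longleftrightarrow>
    (step M ^^ t) (h (False, K), tapes k n s) = (h (False, K'), tapes k n s')"

lemma reaches_trans:
  assumes "reaches n t K s K' s'" "reaches n u K' s' K'' s''"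
  shows "reaches n (t + u) K s K'' s''"
  using assms unfolding reaches_def by (simp add: add.commute[of t] funpow_add)

lemma reaches_keep:
  assumes "c # K \<in> S" "K' \<in> S"
    and trans: "transition k B (False, c # K) (tops k s) = ((False, K'), tops k s, replicate k Stay)"
  shows "reaches n 1 (c # K) s K' s"
proof -
  have "step M (h (False, c # K), tapes k n s) = (h (False, K'), tapes k n s)"
    using step_M[OF assms(1) _ trans[folded read_tapes[of k n]] assms(2)]
    by (simp add: read_tapes map2_act_keep)
  then show ?thesis
    by (simp add: reaches_def)
qed

lemma reaches_pop:
  assumes "c # K \<in> S" "K' \<in> S" "r < k" "s r = x # xs"
    and trans: "transition k B (False, c # K) (tops k s) =
      ((False, K'), (tops k s)[r := 0], (replicate k Stay)[r := bwd r])"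
  shows "reaches n 1 (c # K) s K' (s(r := xs))"
proof -
  have "step M (h (False, c # K), tapes k n s) =
      (h (False, K'), (tapes k n s)[r := act (stack_tape n r (x # xs)) (0, bwd r)])"
    using step_M[OF assms(1) _ trans[folded read_tapes[of k n]] assms(2)] assms(3,4)
    by (simp add: read_tapes map2_act_keep map2_act_update)
  then show ?thesis
    using assms(3) by (simp add: reaches_def act_pop tapes_update)
qed

lemma reaches_push:
  assumes "Push r a # K \<in> S" "K \<in> S" "r < k" "a < B"
  shows "reaches n 2 (Push r a # K) s K (s(r := a # s r))"
proof -
  define ts where "ts = (tapes k n s)[r := grown_tape n r (s r)]"
  have eq: "tops k s = (tops k s)[r := top_of (s r)]"
    using assms by (metis list_update_id nth_tapes(2))
  have "map2 act (tapes k n s) (zip (tops k s) ((replicate k Stay)[r := fwd r])) = ts"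
    by (subst eq) (simp add: map2_act_update map2_act_keep act_grow assms ts_def)
  then have 1: "step M (h (False, Push r a # K), tapes k n s) = (h (True, Push r a # K), ts)"
    using step_M[OF assms(1) _ transition.simps(3) assms(1), of "tapes k n s"] by (simp add: read_tapes)
  let ?ss = "map (\<lambda>t. fst t (snd t)) ts"
  have "map2 act ts (zip ?ss (replicate k Stay)) = ts"
    by (rule nth_equalityI) (auto simp: ts_def act_keep)
  then have "map2 act ts (zip (?ss[r := a]) ((replicate k Stay)[r := Stay])) =
      ts[r := act (ts ! r) (a, Stay)]"
    using assms by (subst map2_act_update) (auto simp: ts_def)
  then have "step M (h (True, Push r a # K), ts) = (h (False, K), ts[r := act (ts ! r) (a, Stay)])"
    using step_M[OF assms(1) _ transition.simps(4) assms(2), of ts] assms(4) by simp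
  also have "ts[r := act (ts ! r) (a, Stay)] = tapes k n (s(r := a # s r))"
    using assms by (simp add: ts_def act_push tapes_update)
  finally show ?thesis
    unfolding reaches_def using 1 by (simp add: numeral_2_eq_2)
qed

text \<open>Each round costs one step for the pop and at most \<open>T\<close> for the body; the
  extra 1 is the step that finds the stack empty.\<close>

lemma run_iter:
  assumes body: "\<And>a s Q. \<lbrakk>a < B; wp k B L (f a) Q s; good k B s\<rbrakk> \<Longrightarrow>
      \<exists>t s'. t \<le> T \<and> reaches n t (f a # For r f # K) s (For r f # K) s' \<and> Q s' \<and> good k B s'"
    and S: "For r f # K \<in> S" "\<And>a. a < B \<Longrightarrow> f a # For r f # K \<in> S" "K \<in> S"
    and r: "r < k"
  shows "\<lbrakk>iter r (\<lambda>a Q s. 0 < a \<and> a < B \<longrightarrow> wp k B L (f a) Q s) xs [] Q s; s r = xs; good k B s\<rbrakk> \<Longrightarrow>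
      \<exists>t s'. t \<le> 1 + length xs * (1 + T) \<and> reaches n t (For r f # K) s K s' \<and> Q s' \<and> good k B s'"
proof (induction xs arbitrary: s)
  case Nil
  then have "reaches n 1 (For r f # K) s K s"
    using S r by (intro reaches_keep) auto
  then show ?case
    using Nil by (intro exI[of _ 1]) auto
next
  case (Cons x xs)
  have x: "0 < x" "x < B"
    using Cons.prems r by (force simp: good_def)+
  have 1: "reaches n 1 (For r f # K) s (f x # For r f # K) (s(r := xs))"
    using S r x Cons.prems by (intro reaches_pop) auto
  have "good k B (s(r := xs))"
    using Cons.prems r unfolding good_def by (metis fun_upd_apply set_subset_Cons subset_trans)
  then obtain t s' where 2: "t \<le> T" "reaches n t (f x # For r f # K) (s(r := xs)) (For r f # K) s'"
    "s' r = xs" "iter r (\<lambda>a Q s. 0 < a \<and> a < B \<longrightarrow> wp k B L (f a) Q s) xs [] Q s'" "good k B s'"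
    using body[OF x(2), where s = "s(r := xs)"
        and Q = "\<lambda>s'. s' r = xs \<and> iter r (\<lambda>a Q s. 0 < a \<and> a < B \<longrightarrow> wp k B L (f a) Q s) xs [] Q s'"] Cons.prems(1) x
    by auto
  obtain u s'' where 3: "u \<le> 1 + length xs * (1 + T)" "reaches n u (For r f # K) s' K s''"
    "Q s''" "good k B s''"
    using Cons.IH[OF 2(4,3,5)] by blast
  have "reaches n (1 + (t + u)) (For r f # K) s K s''"
    by (intro reaches_trans[OF 1] reaches_trans[OF 2(2)] 3(2))
  then show ?case
    using 2 3 by (intro exI[of _ "1 + (t + u)"] exI[of _ s'']) auto
qed

text \<open>The induction is generalised over the continuation \<open>K\<close>, because a sequence
  or a loop runs its parts in front of what is still to be done.\<close>

lemma run_com: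
  "\<lbrakk>wp k B L c Q s; good k B s; conts B c K \<subseteq> S; K \<in> S\<rbrakk> \<Longrightarrow>
    \<exists>t s'. t \<le> poly (run_time B c) L \<and> reaches n t (c # K) s K s' \<and> Q s' \<and> good k B s'"
proof (induction c arbitrary: Q s K)
  case Skip
  then have "reaches n 1 (Skip # K) s K s"
    by (intro reaches_keep) auto
  then show ?case
    using Skip by fastforce
next
  case (Push r a)
  then have "reaches n 2 (Push r a # K) s K (s(r := a # s r))"
    by (intro reaches_push) auto
  then show ?case
    using Push by (intro exI[of _ 2] exI) (auto simp: good_def subset_iff split: if_splits)
next
  case (Pop r)
  have "reaches n 1 (Pop r # K) s K (s(r := tl (s r)))"
  proof (cases "s r")
    case Nil
    then have "reaches n 1 (Pop r # K) s K s"
      using Pop by (intro reaches_keep) auto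
    then show ?thesis
      using Nil by (simp add: fun_upd_idem)
  next
    case (Cons x xs)
    then have "0 < x"
      using Pop.prems by (force simp: good_def)
    then have "reaches n 1 (Pop r # K) s K (s(r := xs))"
      using Pop Cons by (intro reaches_pop) auto
    then show ?thesis
      using Cons by simp
  qed
  moreover have "good k B (s(r := tl (s r)))"
    using Pop.prems unfolding good_def by (metis fun_upd_apply list.sel(2) list.set_sel(2) subset_iff)
  ultimately show ?case
    using Pop by (intro exI[of _ 1]) auto
next
  case (Seq c d)
  have dK: "d # K \<in> S"
    using Seq.prems conts_self[of d K B] by auto
  have cdK: "c # d # K \<in> S"
    using Seq.prems conts_self[of c "d # K" B] by auto
  have 1: "reaches n 1 ((c ;; d) # K) s (c # d # K) s"
    using Seq.prems cdK by (intro reaches_keep) auto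
  obtain t s' where 2: "t \<le> poly (run_time B c) L" "reaches n t (c # d # K) s (d # K) s'"
    "wp k B L d Q s'" "good k B s'"
    using Seq.IH(1)[of "wp k B L d Q" s "d # K"] Seq.prems dK by auto
  obtain u s'' where 3: "u \<le> poly (run_time B d) L" "reaches n u (d # K) s' K s''" "Q s''" "good k B s''"
    using Seq.IH(2)[of Q s' K] Seq.prems 2 by auto
  have "reaches n (1 + (t + u)) ((c ;; d) # K) s K s''"
    by (intro reaches_trans[OF 1] reaches_trans[OF 2(2)] 3(2))
  then show ?case
    using 2 3 by (intro exI[of _ "1 + (t + u)"] exI[of _ s'']) auto
next
  case (Case r f)
  let ?a = "top_of (s r)"
  have a: "?a < B"
    using Case.prems B by (cases "s r") (force simp: good_def)+
  then have C: "conts B (f ?a) K \<subseteq> S"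
    using Case.prems by auto
  then have "f ?a # K \<in> S"
    using conts_self by blast
  then have 1: "reaches n 1 (Case r f # K) s (f ?a # K) s"
    using Case.prems by (intro reaches_keep) auto
  obtain t s' where 2: "t \<le> poly (run_time B (f ?a)) L" "reaches n t (f ?a # K) s K s'"
    "Q s'" "good k B s'"
    using Case.IH[of "f ?a" Q s K] Case.prems C a by auto
  have "reaches n (1 + t) (Case r f # K) s K s'"
    by (intro reaches_trans[OF 1] 2(2))
  then show ?case
    using 2 le_trans[OF 2(1) poly_sum_ge[OF a, of "\<lambda>a. run_time B (f a)"]]
    by (intro exI[of _ "1 + t"] exI[of _ s']) auto
next
  case (For r f)
  let ?T = "poly (\<Sum>a<B. run_time B (f a)) L"
  have FS: "For r f # K \<in> S"
    using For.prems by auto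
  have C: "conts B (f a) (For r f # K) \<subseteq> S" if "a < B" for a
    using For.prems(3) that by auto
  have body: "\<exists>t s'. t \<le> ?T \<and> reaches n t (f a # For r f # K) s (For r f # K) s' \<and> Q s' \<and> good k B s'"
    if a: "a < B" "wp k B L (f a) Q s" "good k B s" for a s Q
  proof -
    obtain t s' where "t \<le> poly (run_time B (f a)) L" "reaches n t (f a # For r f # K) s (For r f # K) s'"
      "Q s'" "good k B s'"
      using For.IH[of "f a" Q s "For r f # K"] a FS C[OF a(1)] by auto
    then show ?thesis
      using poly_sum_ge[OF a(1), of "\<lambda>a. run_time B (f a)" L] le_trans by blast
  qed
  have "f a # For r f # K \<in> S" if "a < B" for a
    using For.prems(3) conts_self[of "f a" "For r f # K" B] that by auto
  then obtain t s' where t: "t \<le> 1 + length (s r) * (1 + ?T)" "reaches n t (For r f # K) s K s'"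
    "Q s'" "good k B s'"
    using run_iter[OF body FS _ For.prems(4), where Q = Q and xs = "s r" and s = s and L = L] For.prems by auto
  \<comment> \<open>The length bound that \<open>wp\<close> demands at loop entry removes the
    dependence on the store.\<close>
  have "length (s r) * (1 + ?T) \<le> L * (1 + ?T)"
    using For.prems by (intro mult_right_mono) auto
  then show ?case
    using t by (intro exI[of _ t] exI[of _ s']) auto
qed

lemma run_program:
  assumes w: "set w \<subseteq> {0<..<B}"
    and wp: "wp k B L c0 (\<lambda>s. s (k - 1) = rev v) ((\<lambda>_. [])(0 := w))"
    and k2: "2 \<le> k" and T: "1 + poly (run_time B c0) L \<le> T"
  shows "computes_within M w v T"
proof -
  let ?n = "length w" and ?s = "(\<lambda>_. [])(0 := w)"
  have good: "good k B ?s"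
    using w by (auto simp: good_def)
  have "step M (init M w) = (h (False, [c0]), tapes k ?n ?s)"
  proof -
    have len: "length (map2 act ((word_tape w, 0) # replicate (k - 1) (word_tape [], 0))
        (zip (map (\<lambda>t. fst t (snd t)) ((word_tape w, 0) # replicate (k - 1) (word_tape [], 0)))
          (Stay # replicate (k - 1) Lft))) = k"
      using k by simp
    \<comment> \<open>Register 0 has the first input symbol on top and its tape grows to the left,
      so the two reversals cancel and the head stands at cell 0.\<close>
    have w0: "word_tape w = (\<lambda>i. word_tape (rev w) (int ?n - i - 1))"
      by (auto simp: word_tape_def fun_eq_iff rev_nth nat_less_iff nat_diff_distrib algebra_simps
          intro!: arg_cong[where f = "(!) w"])
    have "map2 act ((word_tape w, 0) # replicate (k - 1) (word_tape [], 0))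
        (zip (map (\<lambda>t. fst t (snd t)) ((word_tape w, 0) # replicate (k - 1) (word_tape [], 0)))
          (Stay # replicate (k - 1) Lft)) = tapes k ?n ?s"
    proof (rule nth_equalityI)
      fix i assume "i < length (map2 act ((word_tape w, 0) # replicate (k - 1) (word_tape [], 0))
        (zip (map (\<lambda>t. fst t (snd t)) ((word_tape w, 0) # replicate (k - 1) (word_tape [], 0)))
          (Stay # replicate (k - 1) Lft)))"
      then have "i < k"
        using len by simp
      then show "map2 act ((word_tape w, 0) # replicate (k - 1) (word_tape [], 0))
        (zip (map (\<lambda>t. fst t (snd t)) ((word_tape w, 0) # replicate (k - 1) (word_tape [], 0)))
          (Stay # replicate (k - 1) Lft)) ! i = tapes k ?n ?s ! i"
        using w0 by (cases i) (auto simp: act_def stack_tape_def word_tape_def[of "[]"] fun_eq_iff)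
    qed (use len in simp)
    then show ?thesis
      by (simp add: step_def init_def delta_M M_sel)
  qed
  moreover obtain t s' where t: "t \<le> poly (run_time B c0) L" "reaches ?n t [c0] ?s [] s'"
    "s' (k - 1) = rev v" "good k B s'"
    using run_com[OF wp good S_conts S_nil] by blast
  ultimately have "(step M ^^ (Suc t)) (init M w) = (1, tapes k ?n s')"
    by (simp add: funpow_Suc_right reaches_def h_halt del: funpow.simps)
  \<comment> \<open>State 1 is a fixed point of \<open>step\<close>, so a shorter run may be padded
    to exactly \<open>T\<close> steps.\<close>
  moreover have "(step M ^^ u) (1, tapes k ?n s') = (1, tapes k ?n s')" for u
    by (induction u) (simp_all add: step_def)
  ultimately have "(step M ^^ (T - Suc t + Suc t)) (init M w) = (1, tapes k ?n s')"
    by (simp only: funpow_add comp_apply)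
  then have final: "(step M ^^ T) (init M w) = (1, tapes k ?n s')"
    using t T by simp
  have "last (tapes k ?n s') = (word_tape v, int (length v) - 1)"
    using k2 t(3) by (subst last_conv_nth) (auto simp: stack_tape_def simp flip: length_0_conv)
  moreover have "set (s' (k - 1)) \<subseteq> {0<..<B}"
    using t(4) k2 by (simp add: good_def)
  then have "0 \<notin> set v"
    using t(3) by auto
  ultimately show ?thesis
    unfolding computes_within_def M_sel using w final by simp
qed

end

text \<open>\<open>q\<close> bounds the stacks at loop entries by the input length; composing
  \<open>run_time\<close> with \<open>q\<close> then bounds the steps of the machine.\<close>

theorem poly_time_on_program:
  fixes q :: "nat poly"
  assumes "2 \<le> k" "1 \<le> B"
    and "\<And>w. w \<in> I \<Longrightarrow> set w \<subseteq> {0<..<B} \<and>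
      wp k B (poly q (length w)) c (\<lambda>s. s (k - 1) = rev (f w)) ((\<lambda>_. [])(0 := w))"
  shows "poly_time_on I f"
proof -
  define S where "S = insert [] (conts B c [])"
  \<comment> \<open>States 0 and 1 are reserved for start and halt: the empty continuation receives
    1, and the pairs in \<open>A\<close> are numbered from 2 on.\<close>
  define A where "A = UNIV \<times> S - {(False, [])}"
  have "finite A"
    by (simp add: A_def S_def finite_conts)
  then obtain g where g: "bij_betw g A {0..<card A}"
    using ex_bij_betw_finite_nat by blast
  define h where "h x = (if x = (False, []) then 1 else 2 + g x)" for x
  have "compiled k B c S h (2 + card A)"
  proof
    have less: "g x < card A" if "x \<in> A" for x
      using bij_betwE[OF g] that by auto
    have A: "x \<in> A" if "x \<in> UNIV \<times> S" "x \<noteq> (False, [])" for x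
      using that by (simp add: A_def)
    show "inj_on h (UNIV \<times> S)"
    proof (rule inj_onI)
      fix x y
      assume "x \<in> UNIV \<times> S" "y \<in> UNIV \<times> S" "h x = h y"
      then show "x = y"
        using inj_onD[OF bij_betw_imp_inj_on[OF g] _ A A, of x y] unfolding h_def
        by (simp split: if_split_asm)
    qed
    show "h ` (UNIV \<times> S) \<subseteq> {1..<2 + card A}"
      using less[OF A] by (auto simp: h_def) metis
  qed (use assms(1,2) in \<open>auto simp: S_def h_def\<close>)
  then interpret compiled k B c S h "2 + card A" .
  have "computes_within M w (f w) (poly (1 + pcompose (run_time B c) q) (length w))" if "w \<in> I" for w
    using assms that by (intro run_program[where L = "poly q (length w)"]) (auto simp: poly_pcompose)
  then show ?thesis
    unfolding poly_time_on_def using wf by blast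
qed

section \<open>Execution rules\<close>

text \<open>Quantifying over all \<open>Q\<close> turns the weakest precondition into a forward
  statement about one final store, with the length bounds still included.\<close>

definition exec :: "nat \<Rightarrow> nat \<Rightarrow> nat \<Rightarrow> com \<Rightarrow> store \<Rightarrow> store \<Rightarrow> bool" where
  "exec k B L c s s' \<longleftrightarrow> (\<forall>Q. Q s' \<longrightarrow> wp k B L c Q s)"

definition loop :: "nat \<Rightarrow> nat \<Rightarrow> nat \<Rightarrow> nat \<Rightarrow> (nat \<Rightarrow> com) \<Rightarrow> word \<Rightarrow> word \<Rightarrow> store \<Rightarrow> store \<Rightarrow> bool" where
  "loop k B L r f xs ys s s' \<longleftrightarrow>
    (\<forall>Q. Q s' \<longrightarrow> iter r (\<lambda>a Q s. 0 < a \<and> a < B \<longrightarrow> wp k B L (f a) Q s) xs ys Q s)"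

lemma exec_Skip: "exec k B L Skip s s"
  by (simp add: exec_def)

lemma exec_Push: "\<lbrakk>r < k; 0 < a; a < B\<rbrakk> \<Longrightarrow> exec k B L (Push r a) s (s(r := a # s r))"
  by (simp add: exec_def)

lemma exec_Pop: "r < k \<Longrightarrow> exec k B L (Pop r) s (s(r := tl (s r)))"
  by (simp add: exec_def)

lemma exec_Seq: "\<lbrakk>exec k B L c s s'; exec k B L d s' s''\<rbrakk> \<Longrightarrow> exec k B L (c ;; d) s s''"
  by (simp add: exec_def)

lemma exec_Case:
  "\<lbrakk>r < k; top_of (s r) < B \<Longrightarrow> exec k B L (f (top_of (s r))) s s'\<rbrakk> \<Longrightarrow> exec k B L (Case r f) s s'"
  by (simp add: exec_def)

lemma exec_eq: "\<lbrakk>exec k B L c s s'; s' = t\<rbrakk> \<Longrightarrow> exec k B L c s t"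
  by simp

lemma exec_For_loop:
  "\<lbrakk>r < k; length (s r) \<le> L; loop k B L r f (s r) [] s s'\<rbrakk> \<Longrightarrow> exec k B L (For r f) s s'"
  by (simp add: exec_def loop_def)

lemma loop_Nil: "loop k B L r f [] ys s s"
  by (simp add: loop_def)

lemma loop_Cons:
  assumes "\<lbrakk>0 < x; x < B\<rbrakk> \<Longrightarrow> exec k B L (f x) (s(r := xs @ ys)) s1" "s1 r = xs @ ys"
    and "loop k B L r f xs ys s1 s'"
  shows "loop k B L r f (x # xs) ys s s'"
proof -
  have "wp k B L (f x) Q (s(r := xs @ ys))" if "0 < x" "x < B" "Q s1" for Q
    using assms(1) that unfolding exec_def by blast
  then show ?thesis
    using assms(2,3) unfolding loop_def by simp
qed

lemma iter_append: "iter r F (xs @ xs') ys Q s = iter r F xs (xs' @ ys) (iter r F xs' ys Q) s"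
  by (induction xs arbitrary: s) auto

lemma loop_append:
  "\<lbrakk>loop k B L r f xs (xs' @ ys) s s1; loop k B L r f xs' ys s1 s'\<rbrakk> \<Longrightarrow>
    loop k B L r f (xs @ xs') ys s s'"
  by (simp add: loop_def iter_append)

lemma loop_eq: "\<lbrakk>loop k B L r f xs ys s s'; s' = t\<rbrakk> \<Longrightarrow> loop k B L r f xs ys s t"
  by simp

text \<open>Invariant rule: the whole store is given as a function \<open>S\<close> of the prefix
  already consumed, so executing the body on one symbol suffices.\<close>

lemma loop_prefix:
  assumes "S [] = s" "\<And>us vs. xs = us @ vs \<Longrightarrow> S us r = vs @ ys"
    and "\<And>us x vs. \<lbrakk>xs = us @ x # vs; 0 < x; x < B\<rbrakk> \<Longrightarrow>
      exec k B L (f x) ((S us)(r := vs @ ys)) (S (us @ [x]))"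
  shows "loop k B L r f xs ys s (S xs)"
  using assms
proof (induction xs arbitrary: s S)
  case Nil
  then show ?case by (simp add: loop_Nil)
next
  case (Cons x xs)
  have body: "exec k B L (f x') ((S us)(r := vs @ ys)) (S (us @ [x']))"
    if "x # xs = us @ x' # vs" "0 < x'" "x' < B" for us x' vs
    using Cons.prems(3) that by blast
  have "loop k B L r f xs ys (S [x]) (S (x # xs))"
  proof (rule Cons.IH[of "\<lambda>us. S (x # us)"])
    show "exec k B L (f x') ((S (x # us))(r := vs @ ys)) (S (x # us @ [x']))"
      if "xs = us @ x' # vs" "0 < x'" "x' < B" for us x' vs
      using body[of "x # us" x' vs] that by simp
  qed (use Cons.prems in auto)
  moreover have "exec k B L (f x) (s(r := xs @ ys)) (S [x])" if "0 < x" "x < B"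
    using Cons.prems(1) body[of "[]" x xs] that by simp
  moreover have "S [x] r = xs @ ys"
    using Cons.prems(2)[of "[x]" xs] by simp
  ultimately show ?case
    by (rule loop_Cons[rotated 2])
qed

lemma exec_For_prefix:
  assumes "r < k" "length (s r) \<le> L" "S [] = s" "\<And>us vs. s r = us @ vs \<Longrightarrow> S us r = vs"
    and "\<And>us x vs. \<lbrakk>s r = us @ x # vs; 0 < x; x < B\<rbrakk> \<Longrightarrow>
      exec k B L (f x) ((S us)(r := vs)) (S (us @ [x]))"
    and "S (s r) = t"
  shows "exec k B L (For r f) s t"
  using assms loop_prefix[of S s "s r" r "[]" B k L f] by (intro exec_For_loop) auto

primrec pushes :: "nat \<Rightarrow> word \<Rightarrow> com" where
  "pushes r [] = Skip"
| "pushes r (a # w) = pushes r w ;; Push r a"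

lemma exec_pushes:
  "\<lbrakk>r < k; set w \<subseteq> {0<..<B}\<rbrakk> \<Longrightarrow> exec k B L (pushes r w) s (s(r := w @ s r))"
proof (induction w)
  case Nil
  then show ?case by (simp add: exec_Skip)
next
  case (Cons a w)
  then show "exec k B L (pushes r (a # w)) s (s(r := (a # w) @ s r))"
    using exec_Seq[OF Cons.IH exec_Push[of r k a B L "s(r := w @ s r)"]] by simp
qed

definition pour :: "nat \<Rightarrow> nat \<Rightarrow> com" where
  "pour r d = For r (\<lambda>a. Push d a)"

lemma exec_pour:
  assumes "r < k" "d < k" "r \<noteq> d" "length (s r) \<le> L"
  shows "exec k B L (pour r d) s (s(d := rev (s r) @ s d, r := []))"
  unfolding pour_def using assms
  by (intro exec_For_prefix[where S = "\<lambda>us. s(d := rev us @ s d, r := drop (length us) (s r))"])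
    (auto intro!: exec_eq[OF exec_Push])

definition clear :: "nat \<Rightarrow> com" where
  "clear r = For r (\<lambda>_. Skip)"

lemma exec_clear:
  assumes "r < k" "length (s r) \<le> L"
  shows "exec k B L (clear r) s (s(r := []))"
  unfolding clear_def using assms
  by (intro exec_For_prefix[where S = "\<lambda>us. s(r := drop (length us) (s r))"])
    (auto intro!: exec_eq[OF exec_Skip])

text \<open>A stack can only be read by emptying it. Copying therefore goes to two targets, one of
  which serves to restore the source.\<close>

definition pour2 :: "nat \<Rightarrow> nat \<Rightarrow> nat \<Rightarrow> com" where
  "pour2 r d e = For r (\<lambda>a. Push d a ;; Push e a)"

lemma exec_pour2:
  assumes "r < k" "d < k" "e < k" "r \<noteq> d" "r \<noteq> e" "d \<noteq> e" "length (s r) \<le> L"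
  shows "exec k B L (pour2 r d e) s (s(d := rev (s r) @ s d, e := rev (s r) @ s e, r := []))"
  unfolding pour2_def using assms
  by (intro exec_For_prefix[where
        S = "\<lambda>us. s(d := rev us @ s d, e := rev us @ s e, r := drop (length us) (s r))"])
    (auto intro!: exec_eq[OF exec_Seq[OF exec_Push exec_Push]])

text \<open>Moves a word of bounded length from a register into the finite control: the word read so
  far is a parameter of the program text, not part of the store.\<close>

primrec read_word :: "nat \<Rightarrow> nat \<Rightarrow> word \<Rightarrow> (word \<Rightarrow> com) \<Rightarrow> com" where
  "read_word r 0 w g = g w"
| "read_word r (Suc n) w g = Case r (\<lambda>a. if a = 0 then g w else Pop r ;; read_word r n (w @ [a]) g)"

lemma exec_read_word:
  assumes "r < k" "length (s r) \<le> n" "0 \<notin> set (s r)" "exec k B L (g (w @ s r)) (s(r := [])) s'"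
  shows "exec k B L (read_word r n w g) s s'"
  using assms
proof (induction n arbitrary: w s)
  case 0
  then show ?case by (simp add: fun_upd_idem)
next
  case (Suc n)
  show ?case
  proof (cases "s r")
    case Nil
    then show ?thesis
      using Suc.prems by (auto simp: fun_upd_idem intro!: exec_Case)
  next
    case (Cons x xs)
    have g: "exec k B L (g ((w @ [x]) @ xs)) ((s(r := xs))(r := [])) s'"
      using Suc.prems(4) Cons by (simp only: append_assoc append_Cons append_Nil fun_upd_upd)
    have "exec k B L (read_word r n (w @ [x]) g) (s(r := xs)) s'"
    proof (rule Suc.IH)
      show "exec k B L (g ((w @ [x]) @ (s(r := xs)) r)) ((s(r := xs))(r := [])) s'"
        using g by simp
    qed (use Suc.prems Cons in simp_all)
    then show ?thesis
      using Suc.prems Cons by (auto intro!: exec_Case exec_Seq[OF exec_Pop])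
  qed
qed

section \<open>Tokens, templates and their output\<close>

datatype token = Name "bool list" | Mark nat

primrec enc_token :: "token \<Rightarrow> word" where
  "enc_token (Name x) = enc_bits x @ [3]"
| "enc_token (Mark a) = [a]"

definition enc_tokens :: "token list \<Rightarrow> word" where
  "enc_tokens ts = concat (map enc_token ts)"

lemma enc_tokens_simps [simp]:
  "enc_tokens [] = []"
  "enc_tokens (t # ts) = enc_token t @ enc_tokens ts"
  "enc_tokens (ts @ ts') = enc_tokens ts @ enc_tokens ts'"
  by (simp_all add: enc_tokens_def)

text \<open>
  A template is either a fixed prefix followed by the contents of a register, or a mark.
\<close>

type_synonym token_template = "(bool list \<times> nat) + nat"

definition fill :: "(nat \<Rightarrow> bool list) \<Rightarrow> token_template \<Rightarrow> token" where
  "fill c t = (case t of Inl (p, r) \<Rightarrow> Name (p @ c r) | Inr a \<Rightarrow> Mark a)"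

text \<open>A token is pushed back to front. Source registers hold names reversed, so
  \<open>pour2\<close> puts the name on \<open>d\<close> in reading order and leaves a copy in
  register 8, which is poured back.\<close>

definition emit :: "nat \<Rightarrow> token_template \<Rightarrow> com" where
  "emit d t = (case t of
     Inl (p, r) \<Rightarrow> Push d 3 ;; pour2 r d 8 ;; pour 8 r ;; pushes d (enc_bits p)
   | Inr a \<Rightarrow> Push d a)"

primrec emits :: "nat \<Rightarrow> token_template list \<Rightarrow> com" where
  "emits d [] = Skip"
| "emits d (t # ts) = emits d ts ;; emit d t"

lemma set_enc_bits: "set (enc_bits x) \<subseteq> {1, 2}"
  by (auto simp: enc_bits_def)

lemma enc_bits_append [simp]: "enc_bits (x @ y) = enc_bits x @ enc_bits y"
  by (simp add: enc_bits_def)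

lemma length_enc_bits [simp]: "length (enc_bits x) = length x"
  by (simp add: enc_bits_def)

text \<open>Marks above 3 cannot be confused with bits or with the delimiter that ends a
  name.\<close>

fun template_ok :: "nat \<Rightarrow> nat \<Rightarrow> (nat \<Rightarrow> bool) \<Rightarrow> token_template \<Rightarrow> bool" where
  "template_ok k B P (Inl (p, r)) \<longleftrightarrow> r < k \<and> r = 7 \<or> r < k \<and> 20 \<le> r \<and> P r"
| "template_ok k B P (Inr a) \<longleftrightarrow> 3 < a \<and> a < B"

lemma exec_emit:
  assumes "template_ok k B P t" "d < k" "8 < k" "3 < B" "d \<in> {3, 4, 5}" "s 8 = []"
    and "\<And>r. r = 7 \<or> 20 \<le> r \<and> P r \<Longrightarrow> s r = rev (enc_bits (c r)) \<and> length (c r) \<le> L"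
  shows "exec k B L (emit d t) s (s(d := enc_token (fill c t) @ s d))"
proof (cases t)
  case (Inr a)
  then show ?thesis
    using assms by (auto simp: emit_def fill_def intro!: exec_eq[OF exec_Push])
next
  case (Inl pr)
  then obtain p r where t: "t = Inl (p, r)"
    by (cases pr) auto
  have r: "r < k" "r \<noteq> d" "r \<noteq> 8" "s r = rev (enc_bits (c r))" "length (c r) \<le> L"
    using assms(1,5) assms(7)[of r] t by auto
  have p: "set (enc_bits p) \<subseteq> {0<..<B}"
    using set_enc_bits[of p] assms(4) by auto
  have d: "d \<noteq> 8"
    using assms(5) by auto
  show ?thesis
    unfolding t emit_def sum.case prod.case
    apply (rule exec_eq)
     apply (rule exec_Seq, rule exec_Push)
        apply (use assms in simp_all)[3]
     apply (rule exec_Seq, rule exec_pour2)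
            apply (use assms r d in simp_all)[7]
     apply (rule exec_Seq, rule exec_pour)
         apply (use assms r d in simp_all)[4]
     apply (rule exec_pushes)
      apply (use assms r d p in simp_all)[2]
    using r d assms(6) by (auto simp: fill_def fun_eq_iff)
qed

lemma exec_emits:
  assumes "\<forall>t\<in>set ts. template_ok k B P t" "d < k" "8 < k" "3 < B" "d \<in> {3, 4, 5}" "s 8 = []"
    and "\<And>r. r = 7 \<or> 20 \<le> r \<and> P r \<Longrightarrow> s r = rev (enc_bits (c r)) \<and> length (c r) \<le> L"
  shows "exec k B L (emits d ts) s (s(d := enc_tokens (map (fill c) ts) @ s d))"
  using assms(1)
proof (induction ts)
  case Nil
  then show ?case by (simp add: exec_Skip)
next
  case (Cons t ts)
  have d: "d \<noteq> 8" "d \<noteq> 7" "d < 20"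
    using assms(5) by auto
  have "exec k B L (emits d (t # ts)) s ((s(d := enc_tokens (map (fill c) ts) @ s d))
      (d := enc_token (fill c t) @ (s(d := enc_tokens (map (fill c) ts) @ s d)) d))"
    unfolding emits.simps
    apply (rule exec_Seq, rule Cons.IH)
    using Cons.prems apply simp
    apply (rule exec_emit[where P = P])
    using Cons.prems assms d by auto
  then show "exec k B L (emits d (t # ts)) s (s(d := enc_tokens (map (fill c) (t # ts)) @ s d))"
    by simp
qed

section \<open>Substituting one name for another\<close>

text \<open>For segments of the input whose symbols are merely moved to \<open>d\<close>. The body
  may rely on nothing but the mode in register 1, which is constant there.\<close>

lemma loop_pushes:
  assumes "\<And>a s'. \<lbrakk>a \<in> set w; 0 < a; a < B; s' 1 = s 1\<rbrakk> \<Longrightarrow> exec k B L (f a) s' (s'(d := a # s' d))"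
    and "d \<noteq> r" "d \<noteq> 1" "r \<noteq> 1" "s r = w @ ys"
  shows "loop k B L r f w ys s (s(d := rev w @ s d, r := ys))"
proof -
  have "loop k B L r f w ys s ((\<lambda>us. s(d := rev us @ s d, r := drop (length us) w @ ys)) w)"
  proof (rule loop_prefix[where S = "\<lambda>us. s(d := rev us @ s d, r := drop (length us) w @ ys)"])
    fix us x vs
    assume w: "w = us @ x # vs" "0 < x" "x < B"
    show "exec k B L (f x) ((s(d := rev us @ s d, r := drop (length us) w @ ys))(r := vs @ ys))
        (s(d := rev (us @ [x]) @ s d, r := drop (length (us @ [x])) w @ ys))"
      by (rule exec_eq, rule assms(1)) (use assms w in \<open>auto simp: fun_eq_iff\<close>)
  qed (use assms in \<open>auto simp: fun_eq_iff\<close>)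
  then show ?thesis
    by simp
qed

text \<open>
  Registers used for the elimination of one equation \<open>u = v\<close>: 1 mode, 4 token stream, 8 scratch,
  9 and 10 the names \<open>u\<close> and \<open>v\<close>, 11 the current name, 12 mismatches found, 13 scratch, 14 output stream.
\<close>

fun mismatches :: "nat list \<Rightarrow> nat list \<Rightarrow> nat" where
  "mismatches [] us = 0"
| "mismatches (x # xs) us = (if top_of us = x then 0 else 1) + mismatches xs (tl us)"

lemma mismatches_snoc:
  "mismatches (xs @ [x]) us = mismatches xs us + (if top_of (drop (length xs) us) = x then 0 else 1)"
  by (induction xs us rule: mismatches.induct) (auto simp: drop_Suc)

text \<open>The symbol 0 is excluded because \<open>top_of []\<close> would match it; the condition
  on \<open>drop\<close> rules out that \<open>xs\<close> is a proper prefix of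
  \<open>us\<close>.\<close>

lemma mismatches_eq_0:
  "\<lbrakk>0 \<notin> set xs; mismatches xs us = 0; drop (length xs) us = []\<rbrakk> \<Longrightarrow> xs = us"
proof (induction xs us rule: mismatches.induct)
  case (2 x xs us)
  then show ?case
    by (cases us) (auto split: if_splits)
qed auto

lemma mismatches_self: "mismatches xs xs = 0"
  by (induction xs) auto

lemma mismatches_le: "mismatches xs us \<le> length xs"
  by (induction xs us rule: mismatches.induct) auto

text \<open>A loop cannot be left early, so mismatches are collected in register 12 and equality
  means that it is empty. Register 13 keeps what is popped from register 9 for its restoration,
  register 8 keeps the consumed word.\<close>

definition test_eq :: com where
  "test_eq = For 11 (\<lambda>a. Push 8 a ;; Case 9 (\<lambda>b. if b = 0 then Push 12 1
      else Pop 9 ;; Push 13 b ;; (if b = a then Skip else Push 12 1))) ;;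
    Case 9 (\<lambda>b. if b = 0 then Skip else Push 12 1) ;; pour 13 9"

lemma exec_test_eq:
  assumes "20 \<le> k" "20 \<le> B" "length (s 11) \<le> L" "s 8 = []" "s 12 = []" "s 13 = []"
    and "0 \<notin> set (s 11)" "0 \<notin> set (s 9)"
  obtains n where "exec k B L test_eq s (s(11 := [], 8 := rev (s 11), 12 := replicate n 1))"
    and "n = 0 \<longleftrightarrow> s 11 = s 9" "n \<le> Suc (length (s 11))"
proof -
  let ?U = "s 9" and ?X = "s 11"
  define m where "m us = mismatches us ?U" for us
  define S where "S us = s(11 := drop (length us) ?X, 8 := rev us, 9 := drop (length us) ?U,
    13 := rev (take (length us) ?U), 12 := replicate (m us) 1)" for us
  \<comment> \<open>The last summand accounts for symbols of \<open>s 9\<close> left over after the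
    comparison.\<close>
  define n where "n = m ?X + (if drop (length ?X) ?U = [] then 0 else 1)"
  have for1: "exec k B L (For 11 (\<lambda>a. Push 8 a ;; Case 9 (\<lambda>b. if b = 0 then Push 12 1
      else Pop 9 ;; Push 13 b ;; (if b = a then Skip else Push 12 1)))) s (S ?X)"
  proof (rule exec_For_prefix[where S = S])
    show "S [] = s"
      using assms by (auto simp: S_def m_def fun_eq_iff)
    fix us x vs
    assume x: "s 11 = us @ x # vs" "0 < x" "x < B"
    show "exec k B L (Push 8 x ;; Case 9 (\<lambda>b. if b = 0 then Push 12 1
      else Pop 9 ;; Push 13 b ;; (if b = x then Skip else Push 12 1))) ((S us)(11 := vs)) (S (us @ [x]))"
    proof (cases "drop (length us) ?U")
      case Nil
      then have le: "length ?U \<le> length us"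
        by simp
      have "exec k B L (Push 8 x ;; Case 9 (\<lambda>b. if b = 0 then Push 12 1
        else Pop 9 ;; Push 13 b ;; (if b = x then Skip else Push 12 1))) ((S us)(11 := vs))
        ((S us)(11 := vs, 8 := x # S us 8, 12 := 1 # S us 12))"
        apply (rule exec_eq)
         apply (rule exec_Seq, rule exec_Push)
            apply (use assms x in simp_all)[3]
         apply (rule exec_Case)
          apply (use assms in simp)
         apply (simp add: S_def le)
         apply (rule exec_Push)
           apply (use assms in simp_all)[3]
        apply (auto simp: fun_eq_iff S_def le)
        done
      moreover have "m (us @ [x]) = Suc (m us)"
        using x Nil by (simp add: m_def mismatches_snoc)
      ultimately show ?thesis
        using Nil x by (elim exec_eq) (auto simp: fun_eq_iff S_def)
    next
      case (Cons b bs)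
      have b: "b \<noteq> 0"
        using assms(8) Cons by (metis in_set_dropD list.set_intros(1))
      have len: "length us < length ?U"
        using Cons by (metis drop_all leI list.discI)
      have tk: "take (Suc (length us)) ?U = take (length us) ?U @ [b]"
        using Cons len by (metis nth_via_drop take_Suc_conv_app_nth)
      have dr: "drop (Suc (length us)) ?U = bs"
        using Cons by (metis drop_Suc tl_drop list.sel(3))
      have ms: "m (us @ [x]) = m us + (if b = x then 0 else 1)"
        using Cons by (simp add: m_def mismatches_snoc)
      have last: "exec k B L (if b = x then Skip else Push 12 1) t
          (if b = x then t else t(12 := 1 # t 12))" for t
        using assms by (auto intro: exec_Skip exec_eq[OF exec_Push])
      let ?t1 = "(S us)(11 := vs)"
      let ?t2 = "?t1(8 := x # ?t1 8)"
      have t9: "top_of (?t2 9) = b"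
        by (simp add: S_def Cons)
      have e2: "exec k B L (Pop 9 ;; Push 13 b ;; (if b = x then Skip else Push 12 1)) ?t2 (S (us @ [x]))"
        if "b < B"
        apply (rule exec_eq)
         apply (rule exec_Seq, rule exec_Pop)
          apply (use assms in simp)
         apply (rule exec_Seq, rule exec_Push)
            apply (use assms b that in simp_all)[3]
         apply (rule last)
        using x ms tk dr Cons by (auto simp: fun_eq_iff S_def)
      have "exec k B L (Case 9 (\<lambda>b. if b = 0 then Push 12 1
          else Pop 9 ;; Push 13 b ;; (if b = x then Skip else Push 12 1))) ?t2 (S (us @ [x]))"
        by (rule exec_Case) (use assms in simp, simp only: t9 b if_False e2)
      then show ?thesis
        by (intro exec_Seq[OF exec_Push]) (use assms x in auto)
    qed
  qed (use assms in \<open>auto simp: S_def\<close>)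
  have "exec k B L (Case 9 (\<lambda>b. if b = 0 then Skip else Push 12 1)) (S ?X) ((S ?X)(12 := replicate n 1))"
  proof (cases "drop (length ?X) ?U")
    case Nil
    then show ?thesis
      using assms by (auto simp: S_def n_def fun_eq_iff intro!: exec_Case exec_eq[OF exec_Skip])
  next
    case (Cons b bs)
    then have "b \<noteq> 0"
      using assms(8) by (metis in_set_dropD list.set_intros(1))
    then show ?thesis
      using Cons assms by (auto simp: S_def n_def fun_eq_iff intro!: exec_Case exec_eq[OF exec_Push])
  qed
  then have "exec k B L test_eq s (s(11 := [], 8 := rev (s 11), 12 := replicate n 1))"
    unfolding test_eq_def
    apply -
    apply (rule exec_eq)
     apply (rule exec_Seq, rule for1)
     apply (rule exec_Seq, assumption)
     apply (rule exec_pour)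
        apply (use assms in \<open>simp_all add: S_def\<close>)[4]
    apply (use assms in \<open>auto simp: S_def fun_eq_iff\<close>)
    done
  moreover have "n = 0 \<longleftrightarrow> ?X = ?U"
    using mismatches_eq_0[OF assms(7), of ?U] by (auto simp: n_def m_def mismatches_self)
  moreover have "n \<le> Suc (length ?X)"
    using mismatches_le[of ?X ?U] by (simp add: n_def m_def)
  ultimately show ?thesis
    using that by blast
qed

definition subst_word :: com where
  "subst_word = test_eq ;;
    Case 12 (\<lambda>b. if b = 0 then clear 8 ;; pour 10 8 ;; pour2 8 14 10 else pour 8 14) ;;
    clear 12"

text \<open>The bound on register 11 is strict because register 12 can receive one mark more than
  the word has symbols, and \<open>clear\<close> has to consume them all.\<close>

lemma exec_subst_word:
  assumes "20 \<le> k" "20 \<le> B" "length (s 11) < L" "length (s 10) \<le> L" "s 8 = []" "s 12 = []" "s 13 = []"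
    and "0 \<notin> set (s 11)" "0 \<notin> set (s 9)"
  shows "exec k B L subst_word s
    (s(11 := [], 14 := (if s 11 = s 9 then s 10 else s 11) @ s 14))"
proof -
  obtain n where n: "exec k B L test_eq s (s(11 := [], 8 := rev (s 11), 12 := replicate n 1))"
    "n = 0 \<longleftrightarrow> s 11 = s 9" "n \<le> Suc (length (s 11))"
    using exec_test_eq[OF assms(1,2) _ assms(5-9)] assms(3) by (metis less_imp_le)
  let ?s = "s(11 := [], 8 := rev (s 11), 12 := replicate n 1)"
  have "exec k B L (Case 12 (\<lambda>b. if b = 0 then clear 8 ;; pour 10 8 ;; pour2 8 14 10 else pour 8 14)) ?s
    (?s(8 := [], 14 := (if s 11 = s 9 then s 10 else s 11) @ s 14))"
  proof (cases n)
    case 0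
    then have eq: "s 11 = s 9"
      using n by simp
    show ?thesis
      apply (rule exec_Case)
      using assms apply simp
      apply (simp add: 0 eq)
      apply (rule exec_eq)
       apply (rule exec_Seq, rule exec_clear)
         apply (use assms eq in simp_all)[2]
       apply (rule exec_Seq, rule exec_pour)
           apply (use assms eq in simp_all)[4]
       apply (rule exec_pour2)
             apply (use assms eq in simp_all)[7]
      apply (auto simp: eq fun_eq_iff)
      done
  next
    case (Suc n')
    then have "s 11 \<noteq> s 9"
      using n by simp
    then show ?thesis
      using assms Suc by (auto simp: fun_eq_iff intro!: exec_Case exec_eq[OF exec_pour])
  qed
  then show ?thesis
    unfolding subst_word_def
    apply -
    apply (rule exec_eq)
     apply (rule exec_Seq, rule n(1))
     apply (rule exec_Seq, assumption)
     apply (rule exec_clear)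
    using assms n by (auto simp: fun_eq_iff)
qed

definition replace :: "bool list \<Rightarrow> bool list \<Rightarrow> bool list \<Rightarrow> bool list" where
  "replace u v x = (if x = u then v else x)"

primrec rename :: "(bool list \<Rightarrow> bool list) \<Rightarrow> token \<Rightarrow> token" where
  "rename \<rho> (Name x) = Name (\<rho> x)"
| "rename \<rho> (Mark a) = Mark a"

text \<open>Modes 1 and 2 read \<open>u\<close> and \<open>v\<close>, the first two names of the
  stream; mode 3 rewrites the rest, collecting each name in register 11 until its delimiter
  3.\<close>

definition subst_step :: "nat \<Rightarrow> com" where
  "subst_step a = Case 1 (\<lambda>m.
     if m = 1 then (if a = 3 then Pop 1 ;; Push 1 2 else Push 9 a)
     else if m = 2 then (if a = 3 then Pop 1 ;; Push 1 3 else Push 10 a)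
     else if a = 3 then subst_word ;; Push 14 3
     else if a < 3 then Push 11 a else Push 14 a)"

lemma enc_bits_eq_iff [simp]: "enc_bits x = enc_bits y \<longleftrightarrow> x = y"
proof -
  have "inj (\<lambda>b. if b then 2 else 1 :: nat)"
    by (auto simp: inj_def split: if_splits)
  then show ?thesis
    by (simp add: enc_bits_def inj_map_eq_map)
qed

lemma zero_notin_enc_bits [simp]: "0 \<notin> set (enc_bits x)"
  using set_enc_bits[of x] by auto

fun token_ok :: "nat \<Rightarrow> nat \<Rightarrow> token \<Rightarrow> bool" where
  "token_ok B A (Name x) \<longleftrightarrow> length x \<le> A"
| "token_ok B A (Mark a) \<longleftrightarrow> 3 < a \<and> a < B"

lemma loop_subst_tokens:
  assumes kB: "20 \<le> k" "20 \<le> B" and "A < L" and v: "length v \<le> A"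
  shows "\<lbrakk>\<forall>t\<in>set ts. token_ok B A t; s 1 = [3]; s 9 = rev (enc_bits u); s 10 = rev (enc_bits v);
      s 8 = []; s 11 = []; s 12 = []; s 13 = []; s 4 = enc_tokens ts @ ys\<rbrakk> \<Longrightarrow>
    loop k B L 4 subst_step (enc_tokens ts) ys s
      (s(14 := rev (enc_tokens (map (rename (replace u v)) ts)) @ s 14, 4 := ys))"
proof (induction ts arbitrary: s)
  case Nil
  show ?case
    unfolding list.map enc_tokens_simps(1)
    by (rule loop_eq[OF loop_Nil]) (use Nil in \<open>auto simp: fun_eq_iff\<close>)
next
  case (Cons t ts)
  let ?s = "s(14 := rev (enc_token (rename (replace u v) t)) @ s 14, 4 := enc_tokens ts @ ys)"
  have "loop k B L 4 subst_step (enc_token t) (enc_tokens ts @ ys) s ?s"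
  proof (cases t)
    case (Mark a)
    have e: "exec k B L (subst_step a) (s(4 := [] @ enc_tokens ts @ ys))
      ((s(4 := [] @ enc_tokens ts @ ys))(14 := a # s 14))"
      unfolding subst_step_def
      by (rule exec_Case) (use Cons.prems kB Mark in \<open>auto intro!: exec_eq[OF exec_Push]\<close>)
    show ?thesis
      unfolding Mark enc_token.simps
      by (rule loop_eq, rule loop_Cons, rule e, simp, rule loop_Nil) (auto simp: fun_eq_iff)
  next
    case (Name x)
    let ?s1 = "s(11 := rev (enc_bits x) @ s 11, 4 := [3] @ enc_tokens ts @ ys)"
    have 1: "loop k B L 4 subst_step (enc_bits x) ([3] @ enc_tokens ts @ ys) s ?s1"
    proof (rule loop_pushes)
      fix a and s' :: store
      assume a: "a \<in> set (enc_bits x)" "0 < a" "a < B" "s' 1 = s 1"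
      then have "a < 3"
        using set_enc_bits[of x] by auto
      then show "exec k B L (subst_step a) s' (s'(11 := a # s' 11))"
        unfolding subst_step_def
        by (intro exec_Case) (use a Cons.prems kB in \<open>auto intro!: exec_eq[OF exec_Push]\<close>)
    qed (use Cons.prems Name in auto)
    let ?s2 = "?s1(4 := [] @ enc_tokens ts @ ys)"
    have "exec k B L subst_word ?s2 (?s2(11 := [], 14 := (if ?s2 11 = ?s2 9 then ?s2 10 else ?s2 11) @ ?s2 14))"
      by (rule exec_subst_word) (use Cons.prems assms Name in auto)
    then have "exec k B L (subst_word ;; Push 14 3) ?s2 ?s"
      apply -
      apply (rule exec_eq)
       apply (rule exec_Seq, assumption)
       apply (rule exec_Push)
         apply (use kB in simp_all)[3]
      apply (use Cons.prems in \<open>auto simp: Name replace_def fun_eq_iff\<close>)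
      done
    then have "exec k B L (subst_step 3) ?s2 ?s"
      unfolding subst_step_def using Cons.prems kB by (intro exec_Case) auto
    then have 2: "loop k B L 4 subst_step [3] (enc_tokens ts @ ys) ?s1 ?s"
      by (intro loop_Cons[OF _ _ loop_Nil]) auto
    show ?thesis
      unfolding Name enc_token.simps(1) by (rule loop_append[OF 1 2[unfolded Name]])
  qed
  moreover have "loop k B L 4 subst_step (enc_tokens ts) ys ?s
      (?s(14 := rev (enc_tokens (map (rename (replace u v)) ts)) @ ?s 14, 4 := ys))"
    by (rule Cons.IH) (use Cons.prems in auto)
  ultimately have "loop k B L 4 subst_step (enc_token t @ enc_tokens ts) ys s
      (?s(14 := rev (enc_tokens (map (rename (replace u v)) ts)) @ ?s 14, 4 := ys))"
    by (rule loop_append)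
  then show ?case
    unfolding enc_tokens_simps(2) by (rule loop_eq) (auto simp: fun_eq_iff)
qed

definition subst_pass :: com where
  "subst_pass = Push 1 1 ;; For 4 subst_step ;; Pop 1 ;; clear 9 ;; clear 10 ;; pour 14 4"

text \<open>The stream is cut into \<open>u\<close>, its delimiter, \<open>v\<close>, its delimiter
  and the rest. The mode changes only at the two delimiters, and the pieces are glued by
  \<open>loop_append\<close>.\<close>

lemma exec_subst_pass:
  assumes kB: "20 \<le> k" "20 \<le> B" and A: "A < L" "length u \<le> A" "length v \<le> A"
    and ts: "\<forall>t\<in>set ts. token_ok B A t"
    and s4: "s 4 = enc_tokens (Name u # Name v # ts)"
    and z: "s 1 = []" "s 8 = []" "s 9 = []" "s 10 = []" "s 11 = []" "s 12 = []" "s 13 = []" "s 14 = []"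
    and len: "length (s 4) \<le> L" "length (enc_tokens (map (rename (replace u v)) ts)) \<le> L"
  shows "exec k B L subst_pass s (s(4 := enc_tokens (map (rename (replace u v)) ts)))"
proof -
  let ?s0 = "s(1 := [1])"
  let ?s1 = "?s0(9 := rev (enc_bits u) @ ?s0 9, 4 := [3] @ enc_bits v @ [3] @ enc_tokens ts)"
  have bits: "a < 3" if "a \<in> set (enc_bits x)" for a x
    using that set_enc_bits[of x] by auto
  have 1: "loop k B L 4 subst_step (enc_bits u) ([3] @ enc_bits v @ [3] @ enc_tokens ts) ?s0 ?s1"
  proof (rule loop_pushes)
    fix a and s' :: store
    assume "a \<in> set (enc_bits u)" "0 < a" "a < B" "s' 1 = ?s0 1"
    then show "exec k B L (subst_step a) s' (s'(9 := a # s' 9))"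
      unfolding subst_step_def using kB bits[of a u]
      by (intro exec_Case) (auto intro!: exec_eq[OF exec_Push])
  qed (use s4 in auto)
  let ?s2 = "?s1(1 := [2], 4 := enc_bits v @ [3] @ enc_tokens ts)"
  have 2: "loop k B L 4 subst_step [3] (enc_bits v @ [3] @ enc_tokens ts) ?s1 ?s2"
    apply (rule loop_Cons[OF _ _ loop_Nil])
     apply (unfold subst_step_def)
     apply (rule exec_Case)
    using kB apply simp
     apply simp
     apply (rule exec_eq)
      apply (rule exec_Seq, rule exec_Pop)
    using kB apply simp
      apply (rule exec_Push)
    using kB by (auto simp: fun_eq_iff)
  let ?s3 = "?s2(10 := rev (enc_bits v) @ ?s2 10, 4 := [3] @ enc_tokens ts)"
  have 3: "loop k B L 4 subst_step (enc_bits v) ([3] @ enc_tokens ts) ?s2 ?s3"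
  proof (rule loop_pushes)
    fix a and s' :: store
    assume "a \<in> set (enc_bits v)" "0 < a" "a < B" "s' 1 = ?s2 1"
    then show "exec k B L (subst_step a) s' (s'(10 := a # s' 10))"
      unfolding subst_step_def using kB bits[of a v]
      by (intro exec_Case) (auto intro!: exec_eq[OF exec_Push])
  qed (use s4 in auto)
  let ?s4 = "?s3(1 := [3], 4 := enc_tokens ts)"
  have 4: "loop k B L 4 subst_step [3] (enc_tokens ts @ []) ?s3 ?s4"
    apply (rule loop_Cons[OF _ _ loop_Nil])
     apply (unfold subst_step_def)
     apply (rule exec_Case)
    using kB apply simp
     apply simp
     apply (rule exec_eq)
      apply (rule exec_Seq, rule exec_Pop)
    using kB apply simp
      apply (rule exec_Push)
    using kB by (auto simp: fun_eq_iff)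
  let ?s5 = "?s4(14 := rev (enc_tokens (map (rename (replace u v)) ts)) @ ?s4 14, 4 := [])"
  have 5: "loop k B L 4 subst_step (enc_tokens ts) [] ?s4 ?s5"
    by (rule loop_subst_tokens[OF kB A(1,3) ts]) (use z in auto)
  have eq: "?s0 4 = enc_bits u @ [3] @ enc_bits v @ [3] @ enc_tokens ts"
    using s4 by simp
  have "loop k B L 4 subst_step ([3] @ enc_tokens ts) [] ?s3 ?s5"
    by (rule loop_append[OF 4 5])
  then have "loop k B L 4 subst_step (enc_bits v @ [3] @ enc_tokens ts) [] ?s2 ?s5"
    by (rule loop_append[rotated]) (simp only: append_assoc append_Nil2 3)
  then have "loop k B L 4 subst_step ([3] @ enc_bits v @ [3] @ enc_tokens ts) [] ?s1 ?s5"
    by (rule loop_append[rotated]) (simp only: append_assoc append_Nil2 2)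
  then have "loop k B L 4 subst_step (?s0 4) [] ?s0 ?s5"
    unfolding eq by (rule loop_append[rotated]) (simp only: append_assoc append_Nil2 1)
  then have f: "exec k B L (For 4 subst_step) ?s0 ?s5"
    using len kB by (intro exec_For_loop) auto
  have p: "exec k B L (Push 1 1) s ?s0"
    by (rule exec_eq, rule exec_Push) (use kB z in auto)
  show ?thesis
    unfolding subst_pass_def
    apply (rule exec_eq)
     apply (rule exec_Seq, rule p)
     apply (rule exec_Seq, rule f)
     apply (rule exec_Seq, rule exec_Pop)
      apply (use kB in simp)
     apply (rule exec_Seq, rule exec_clear)
       apply (use kB A z in simp_all)[2]
     apply (rule exec_Seq, rule exec_clear)
       apply (use kB A z in simp_all)[2]
     apply (rule exec_pour)
        apply (use kB A z len in simp_all)[4]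
    apply (use z in \<open>auto simp: fun_eq_iff\<close>)
    done
qed

section \<open>Reading an instance\<close>

text \<open>Each substitution is also applied to the remaining equations, so that these cannot bring
  back an eliminated name. The counter is needed because no mark separates the equations from the
  variable names after them.\<close>

primrec eliminate :: "nat \<Rightarrow> token list \<Rightarrow> token list" where
  "eliminate 0 ts = ts"
| "eliminate (Suc n) ts = (case ts of
     Name u # Name v # ts' \<Rightarrow> eliminate n (map (rename (replace u v)) ts')
   | _ \<Rightarrow> ts)"

definition pair_tokens :: "(bool list \<times> bool list) list \<Rightarrow> token list" where
  "pair_tokens E = concat (map (\<lambda>(u, v). [Name u, Name v]) E)"

lemma pair_tokens_simps [simp]:
  "pair_tokens [] = []"
  "pair_tokens ((u, v) # E) = Name u # Name v # pair_tokens E"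
  by (simp_all add: pair_tokens_def)

lemma map_rename_pair_tokens:
  "map (rename \<rho>) (pair_tokens E) = pair_tokens (map (map_prod \<rho> \<rho>) E)"
  by (induction E) auto

lemma token_ok_replace:
  "\<lbrakk>token_ok B A t; length v \<le> A\<rbrakk> \<Longrightarrow> token_ok B A (rename (replace u v) t)"
  by (cases t) (auto simp: replace_def)

lemma length_enc_tokens_le:
  "\<forall>t\<in>set ts. token_ok B A t \<Longrightarrow> length (enc_tokens ts) \<le> length ts * Suc A"
proof (induction ts)
  case (Cons t ts)
  have "length (enc_token t) \<le> Suc A"
    using Cons.prems by (cases t) auto
  then show ?case
    using Cons by simp
qed simp

text \<open>Induction on the number of equations, since a pass renames those that remain. The token
  bound \<open>A\<close> survives a pass because \<open>v\<close> is itself a name of the stream,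
  and the number of tokens only decreases.\<close>

lemma loop_subst:
  assumes kB: "20 \<le> k" "20 \<le> B" and A: "A < L"
  shows "\<lbrakk>s 4 = enc_tokens (pair_tokens E @ ts); \<forall>t\<in>set (pair_tokens E @ ts). token_ok B A t;
      length (pair_tokens E @ ts) * Suc A \<le> L; s 6 = replicate (length E) 1;
      s 1 = []; s 8 = []; s 9 = []; s 10 = []; s 11 = []; s 12 = []; s 13 = []; s 14 = []\<rbrakk> \<Longrightarrow>
    loop k B L 6 (\<lambda>_. subst_pass) (replicate (length E) 1) [] s
      (s(4 := enc_tokens (eliminate (length E) (pair_tokens E @ ts)), 6 := []))"
proof (induction "length E" arbitrary: E ts s)
  case 0
  then have "loop k B L 6 (\<lambda>_. subst_pass) [] [] s
      (s(4 := enc_tokens (eliminate (length E) (pair_tokens E @ ts)), 6 := []))"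
    by (intro loop_eq[OF loop_Nil]) (auto simp: fun_eq_iff)
  then show "loop k B L 6 (\<lambda>_. subst_pass) (replicate (length E) 1) [] s
      (s(4 := enc_tokens (eliminate (length E) (pair_tokens E @ ts)), 6 := []))"
    using 0(1) by simp
next
  case (Suc n)
  then obtain u v E' where E: "E = (u, v) # E'" and n: "n = length E'"
    by (cases E) auto
  let ?\<rho> = "replace u v"
  let ?E = "map (map_prod ?\<rho> ?\<rho>) E'" and ?ts = "map (rename ?\<rho>) ts"
  have uv: "length u \<le> A" "length v \<le> A" and ok: "\<forall>t\<in>set (pair_tokens E' @ ts). token_ok B A t"
    using Suc.prems(2) by (auto simp: E)
  have eq: "map (rename ?\<rho>) (pair_tokens E' @ ts) = pair_tokens ?E @ ?ts"
    by (simp add: map_rename_pair_tokens)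
  have ok': "\<forall>t\<in>set (pair_tokens ?E @ ?ts). token_ok B A t"
    unfolding eq[symmetric] using ok token_ok_replace[OF _ uv(2)] by auto
  have length_eq: "length (pair_tokens ?E @ ?ts) = length (pair_tokens E' @ ts)"
    unfolding eq[symmetric] by simp
  then have len': "length (pair_tokens ?E @ ?ts) * Suc A \<le> L"
    using Suc.prems(3) by (simp add: E)
  let ?s0 = "s(6 := replicate n 1 @ [])"
  let ?s1 = "?s0(4 := enc_tokens (map (rename ?\<rho>) (pair_tokens E' @ ts)))"
  have pass: "exec k B L subst_pass ?s0 ?s1"
  proof (rule exec_subst_pass[OF kB A uv ok])
    show "length (?s0 4) \<le> L"
      using length_enc_tokens_le[OF Suc.prems(2)] Suc.prems(1,3) by simp
    show "length (enc_tokens (map (rename ?\<rho>) (pair_tokens E' @ ts))) \<le> L"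
      unfolding eq using length_enc_tokens_le[OF ok'] len' by simp
  qed (use Suc.prems in \<open>simp_all add: E\<close>)
  have "loop k B L 6 (\<lambda>_. subst_pass) (replicate (length ?E) 1) [] ?s1
      (?s1(4 := enc_tokens (eliminate (length ?E) (pair_tokens ?E @ ?ts)), 6 := []))"
    by (rule Suc.hyps(1)) (use Suc.prems ok' len' n in \<open>auto simp: map_rename_pair_tokens\<close>)
  then have "loop k B L 6 (\<lambda>_. subst_pass) (replicate n 1) [] ?s1
      (?s1(4 := enc_tokens (eliminate n (pair_tokens ?E @ ?ts)), 6 := []))"
    by (simp only: n length_map)
  then have "loop k B L 6 (\<lambda>_. subst_pass) (1 # replicate n 1) [] s
      (?s1(4 := enc_tokens (eliminate n (pair_tokens ?E @ ?ts)), 6 := []))"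
    by (rule loop_Cons[rotated 2]) (rule pass, simp)
  moreover have "replicate (length E) 1 = (1 # replicate n 1 :: nat list)"
    by (simp add: E n)
  moreover have "eliminate (length E) (pair_tokens E @ ts) = eliminate n (pair_tokens ?E @ ?ts)"
    by (simp add: E n map_rename_pair_tokens)
  ultimately show "loop k B L 6 (\<lambda>_. subst_pass) (replicate (length E) 1) [] s
      (s(4 := enc_tokens (eliminate (length E) (pair_tokens E @ ts)), 6 := []))"
    by (auto elim!: loop_eq simp: fun_eq_iff)
qed

text \<open>
  Registers used for reading the instance: 0 input, 1 mode, 2 relation of the current constraint,
  3 equations, 4 constraints, 5 variables, 6 number of equations in unary, 7 number of constraints
  read so far in unary, 8 scratch, \<open>20 + i\<close> the \<open>i\<close>-th variable of the current constraint.
\<close>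

primrec clears :: "nat \<Rightarrow> com" where
  "clears 0 = Skip"
| "clears (Suc n) = clears n ;; clear (20 + n)"

lemma exec_clears:
  "\<lbrakk>20 + n \<le> k; \<And>i. i < n \<Longrightarrow> length (s (20 + i)) \<le> L\<rbrakk> \<Longrightarrow>
    exec k B L (clears n) s (\<lambda>r. if 20 \<le> r \<and> r < 20 + n then [] else s r)"
proof (induction n)
  case 0
  show ?case
    unfolding clears.simps by (rule exec_eq[OF exec_Skip]) (auto simp: fun_eq_iff)
next
  case (Suc n)
  show ?case
    unfolding clears.simps
    by (rule exec_eq, rule exec_Seq, rule Suc.IH)
      (use Suc.prems in \<open>auto intro!: exec_clear simp: fun_eq_iff\<close>)
qed

lemma enc_list_simps [simp]:
  "enc_list [] = []" "enc_list (x # xs) = enc_bits x @ [3] @ enc_list xs"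
  by (simp_all add: enc_list_def)

lemma set_enc_list: "set (enc_list xs) \<subseteq> {1, 2, 3}"
  using set_enc_bits by (induction xs) fastforce+

lemma append_delim_inject:
  "\<lbrakk>u @ d # w = u' @ d' # w'; d \<notin> set u; d \<notin> set u'; d' \<notin> set u; d' \<notin> set u'\<rbrakk> \<Longrightarrow>
    u = u' \<and> d = d' \<and> w = w'"
proof (induction u arbitrary: u')
  case Nil
  then show ?case by (cases u') auto
next
  case (Cons a u)
  then show ?case by (cases u') auto
qed

text \<open>Every entry ends with 3 and the list is closed by a symbol above 3, so the first symbol
  at or above 3 always tells where to cut.\<close>

lemma enc_list_inject:
  "\<lbrakk>enc_list xs @ d # w = enc_list ys @ d' # w'; d > 3; d' > 3\<rbrakk> \<Longrightarrow> xs = ys \<and> d = d' \<and> w = w'"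
proof (induction xs arbitrary: ys)
  case Nil
  have "d \<noteq> hd (enc_bits y @ 3 # z)" for y z
    using set_enc_bits[of y] Nil by (cases "enc_bits y") auto
  with Nil show ?case
    by (cases ys) (auto simp: neq_Nil_conv dest: arg_cong[where f = hd])
next
  case (Cons x xs)
  have "d' \<noteq> hd (enc_bits x @ 3 # z)" for z
    using set_enc_bits[of x] Cons.prems by (cases "enc_bits x") auto
  with Cons.prems obtain y zs where ys: "ys = y # zs"
    by (cases ys) (simp, metis list.sel(1), simp)
  have 3: "3 \<notin> set (enc_bits z)" for z
    using set_enc_bits[of z] by auto
  have "enc_bits x = enc_bits y \<and> enc_list xs @ d # w = enc_list zs @ d' # w'"
    using append_delim_inject[of "enc_bits x" 3 _ "enc_bits y" 3] Cons.prems 3 by (simp add: ys)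
  then show ?case
    using Cons.IH[of zs] Cons.prems by (simp add: ys)
qed

text \<open>The content of register 2, top first, once a constraint has been read: one 3 per
  variable, the 4, and the tuples in reverse. The arity is part of the key because the empty
  relation does not determine it.\<close>

definition key_word :: "bool list list \<Rightarrow> nat \<Rightarrow> word" where
  "key_word ts n = replicate n 3 @ 4 # rev (enc_list ts)"

lemma key_word_inject: "key_word ts n = key_word ts' n' \<longleftrightarrow> ts = ts' \<and> n = n'"
proof
  assume eq: "key_word ts n = key_word ts' n'"
  have 4: "4 \<notin> set (enc_list z)" for z
    using set_enc_list[of z] by auto
  have "enc_list ts = enc_list ts' \<and> replicate n 3 = (replicate n' 3 :: nat list)"
    using append_delim_inject[of "enc_list ts" 4 "replicate n 3" "enc_list ts'" 4 "replicate n' 3"]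
      arg_cong[OF eq, of rev] 4[of ts] 4[of ts'] by (simp add: key_word_def)
  moreover from this have "n = n'"
    by (metis length_replicate)
  ultimately show "ts = ts' \<and> n = n'"
    using enc_list_inject[of ts 4 "[]" ts' 4 "[]"] by simp
qed simp

text \<open>Register 7 is a unary counter; its symbol 1 is also the code of the bit
  \<open>False\<close>, so the counter can be used as a piece of a name.\<close>

definition contents :: "nat \<Rightarrow> var list \<Rightarrow> nat \<Rightarrow> bool list" where
  "contents i xs r = (if r = 7 then replicate i False else xs ! (r - 20))"

type_synonym templates = "bool list list \<Rightarrow> nat \<Rightarrow> token_template list"

text \<open>Later constraints come first because the pieces are pushed onto stacks.\<close>

fun expansion :: "templates \<Rightarrow> nat \<Rightarrow> constraint list \<Rightarrow> token list" where
  "expansion f i [] = []"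
| "expansion f i ((ts, xs) # cs) =
    expansion f (Suc i) cs @ map (fill (contents i xs)) (f ts (length xs))"

text \<open>
  The tuples of a relation are written to the token stream with all symbols shifted by 10, so that
  they are not mistaken for variable names when names are substituted.
\<close>

definition unshift :: "nat \<Rightarrow> nat" where
  "unshift a = (if 10 < a then a - 10 else a)"

text \<open>\<open>K\<close> bounds the arities and \<open>n0\<close> the lengths of the keys.
  Registers from 20 on hold variables, and the last one, \<open>21 + K\<close>, the output. The
  alphabet must contain the shifted symbols, up to 14, and the modes, up to
  \<open>3 + K\<close>.\<close>

locale expander =
  fixes K n0 k B :: nat and tE tD tV :: templates and cnt :: "bool list list \<Rightarrow> nat \<Rightarrow> nat"
    and keys :: "(bool list list \<times> nat) set"
  assumes k: "k = 22 + K" and B: "B = 25 + K"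
    and keys: "(ts, n) \<in> keys \<Longrightarrow> n \<le> K \<and> length (key_word ts n) \<le> n0 \<and>
      (\<forall>t\<in>set (tE ts n) \<union> set (tD ts n) \<union> set (tV ts n). template_ok k B (\<lambda>r. r < 20 + n) t)"
begin

definition expand :: "bool list list \<Rightarrow> nat \<Rightarrow> com" where
  "expand ts n = emits 3 (tE ts n) ;; emits 4 (tD ts n) ;; emits 5 (tV ts n) ;;
    pushes 6 (replicate (cnt ts n) 1) ;; clears n ;; Push 7 1"

text \<open>The choice is made when the program is built, not when it runs: each leaf of the
  decision tree \<open>read_word\<close> contains the fixed program for its word.\<close>

definition dispatch :: "word \<Rightarrow> com" where
  "dispatch w = (case SOME p. w = key_word (fst p) (snd p) of (ts, n) \<Rightarrow> expand ts n)"

lemma dispatch_key_word: "dispatch (key_word ts n) = expand ts n"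
proof -
  have "(SOME p. key_word ts n = key_word (fst p) (snd p)) = (ts, n)"
    by (rule some_equality) (auto simp: key_word_inject)
  then show ?thesis
    by (simp add: dispatch_def)
qed

text \<open>
  Mode 1 reads the list of variables, mode 2 the tuples of a relation, and mode \<open>3 + i\<close> the \<open>i\<close>-th
  variable of a constraint.
\<close>

definition parse_step :: "nat \<Rightarrow> com" where
  "parse_step a = Case 1 (\<lambda>m.
     if m = 1 then (if a = 3 then emit 5 (Inl ([False], 20)) ;; clear 20
       else if a = 5 then Pop 1 ;; Push 1 2 else Push 20 a)
     else if m = 2 then (if a = 4 then Push 2 a ;; Pop 1 ;; Push 1 3 else Push 2 a)
     else (if a = 3 then Push 2 3 ;; Pop 1 ;; Push 1 (Suc m)
       else if a = 5 then Pop 1 ;; Push 1 2 ;; read_word 2 n0 [] dispatch else Push (17 + m) a))"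

lemma exec_expand:
  assumes key: "(ts, length xs) \<in> keys" and s7: "s 7 = replicate i 1" and s8: "s 8 = []"
    and X: "\<And>j. j < length xs \<Longrightarrow> s (20 + j) = rev (enc_bits (xs ! j))"
    and len: "\<And>x. x \<in> set xs \<Longrightarrow> length x \<le> L" "i \<le> L"
  shows "exec k B L (expand ts (length xs)) s (\<lambda>r. if 20 \<le> r \<and> r < 20 + length xs then [] else
    (s(3 := enc_tokens (map (fill (contents i xs)) (tE ts (length xs))) @ s 3,
       4 := enc_tokens (map (fill (contents i xs)) (tD ts (length xs))) @ s 4,
       5 := enc_tokens (map (fill (contents i xs)) (tV ts (length xs))) @ s 5,
       6 := replicate (cnt ts (length xs)) 1 @ s 6, 7 := 1 # s 7)) r)"
proof -
  let ?n = "length xs"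
  have n: "?n \<le> K"
    using keys[OF key] by simp
  have src: "s r = rev (enc_bits (contents i xs r)) \<and> length (contents i xs r) \<le> L"
    if "r = 7 \<or> 20 \<le> r \<and> r < 20 + ?n" for r
  proof (cases "r = 7")
    case True
    then show ?thesis
      using s7 len(2) by (simp add: contents_def enc_bits_def)
  next
    case False
    then obtain j where "r = 20 + j" "j < ?n"
      using \<open>r = 7 \<or> 20 \<le> r \<and> r < 20 + ?n\<close> by (metis add_less_cancel_left le_add_diff_inverse)
    then show ?thesis
      using X[of j] len(1)[of "xs ! j"] by (simp add: contents_def)
  qed
  note ok = keys[OF key]
  show ?thesis
    unfolding expand_def
    apply (rule exec_eq)
     apply (rule exec_Seq, rule exec_emits[where P = "\<lambda>r. r < 20 + ?n" and c = "contents i xs"])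
           apply (use ok k B s8 src in auto)[7]
     apply (rule exec_Seq, rule exec_emits[where P = "\<lambda>r. r < 20 + ?n" and c = "contents i xs"])
           apply (use ok k B s8 src in auto)[7]
     apply (rule exec_Seq, rule exec_emits[where P = "\<lambda>r. r < 20 + ?n" and c = "contents i xs"])
           apply (use ok k B s8 src in auto)[7]
     apply (rule exec_Seq, rule exec_pushes)
       apply (use k B in auto)[2]
     apply (rule exec_Seq, rule exec_clears)
       apply (use k n in simp)
      apply (use X len in simp)
     apply (rule exec_Push)
       apply (use k B in auto)[3]
    apply (auto simp: fun_eq_iff)
    done
qed

text \<open>Generalised over the number \<open>j\<close> of variables already read, which the mode
  records and which selects the target register.\<close>

lemma loop_variables:
  "\<lbrakk>s 1 = [3 + j]; s 0 = enc_list xs @ ys; j + length xs \<le> K;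
    \<And>r. 20 + j \<le> r \<Longrightarrow> r < 20 + j + length xs \<Longrightarrow> s r = []\<rbrakk> \<Longrightarrow>
    loop k B L 0 parse_step (enc_list xs) ys s
      (\<lambda>r. if 20 + j \<le> r \<and> r < 20 + j + length xs then rev (enc_bits (xs ! (r - 20 - j)))
        else (s(0 := ys, 1 := [3 + j + length xs], 2 := replicate (length xs) 3 @ s 2)) r)"
proof (induction xs arbitrary: s j)
  case Nil
  show ?case
    unfolding enc_list_simps(1) by (rule loop_eq[OF loop_Nil]) (use Nil in \<open>auto simp: fun_eq_iff\<close>)
next
  case (Cons x xs)
  have jK: "j < K"
    using Cons.prems(3) by simp
  let ?s1 = "s(20 + j := rev (enc_bits x) @ s (20 + j), 0 := [3] @ enc_list xs @ ys)"
  have 1: "loop k B L 0 parse_step (enc_bits x) ([3] @ enc_list xs @ ys) s ?s1"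
  proof (rule loop_pushes)
    fix a and s' :: store
    assume a: "a \<in> set (enc_bits x)" "0 < a" "a < B" "s' 1 = s 1"
    then have "a < 3"
      using set_enc_bits[of x] by auto
    then show "exec k B L (parse_step a) s' (s'(20 + j := a # s' (20 + j)))"
      unfolding parse_step_def
      by (intro exec_Case) (use a Cons.prems k B jK in \<open>auto intro!: exec_eq[OF exec_Push]\<close>)
  qed (use Cons.prems in auto)
  let ?s2 = "?s1(0 := [] @ enc_list xs @ ys, 2 := 3 # s 2, 1 := [4 + j])"
  have 2: "loop k B L 0 parse_step [3] (enc_list xs @ ys) ?s1 ?s2"
    apply (rule loop_Cons[OF _ _ loop_Nil])
     apply (unfold parse_step_def)
     apply (rule exec_Case)
    using k apply simp
    using Cons.prems(1) apply simp
     apply (rule exec_eq)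
      apply (rule exec_Seq, rule exec_Push)
         apply (use k B in simp_all)[3]
      apply (rule exec_Seq, rule exec_Pop)
       apply (use k in simp)
      apply (rule exec_Push)
        apply (use k B jK in simp_all)[3]
     apply (auto simp: fun_eq_iff)
    done
  have 3: "loop k B L 0 parse_step (enc_list xs) ys ?s2
      (\<lambda>r. if 20 + Suc j \<le> r \<and> r < 20 + Suc j + length xs then rev (enc_bits (xs ! (r - 20 - Suc j)))
        else (?s2(0 := ys, 1 := [3 + Suc j + length xs], 2 := replicate (length xs) 3 @ ?s2 2)) r)"
    by (rule Cons.IH) (use Cons.prems in auto)
  have "loop k B L 0 parse_step ([3] @ enc_list xs) ys ?s1
      (\<lambda>r. if 20 + Suc j \<le> r \<and> r < 20 + Suc j + length xs then rev (enc_bits (xs ! (r - 20 - Suc j)))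
        else (?s2(0 := ys, 1 := [3 + Suc j + length xs], 2 := replicate (length xs) 3 @ ?s2 2)) r)"
    by (rule loop_append[OF 2 3])
  then have "loop k B L 0 parse_step (enc_bits x @ [3] @ enc_list xs) ys s
      (\<lambda>r. if 20 + Suc j \<le> r \<and> r < 20 + Suc j + length xs then rev (enc_bits (xs ! (r - 20 - Suc j)))
        else (?s2(0 := ys, 1 := [3 + Suc j + length xs], 2 := replicate (length xs) 3 @ ?s2 2)) r)"
    by (rule loop_append[rotated]) (simp only: append_assoc 1)
  then show "loop k B L 0 parse_step (enc_list (x # xs)) ys s
      (\<lambda>r. if 20 + j \<le> r \<and> r < 20 + j + length (x # xs) then rev (enc_bits ((x # xs) ! (r - 20 - j)))
        else (s(0 := ys, 1 := [3 + j + length (x # xs)], 2 := replicate (length (x # xs)) 3 @ s 2)) r)"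
    unfolding enc_list_simps(2)
    by (rule loop_eq)
      (use Cons.prems in \<open>auto simp: fun_eq_iff nth_Cons' replicate_app_Cons_same\<close>)
qed

text \<open>The constraint is cut into tuples, 4, variables and 5. The closing 5 triggers the
  lookup; afterwards the mode is 2 again and the key and variable registers are empty, ready for the
  next constraint.\<close>

lemma loop_constraint:
  assumes key: "(ts, length xs) \<in> keys"
    and s: "s 1 = [2]" "s 2 = []" "s 7 = replicate i 1" "s 8 = []" "\<And>r. 20 \<le> r \<Longrightarrow> s r = []"
    and s0: "s 0 = enc_constraint (ts, xs) @ ys"
    and len: "\<And>x. x \<in> set xs \<Longrightarrow> length x \<le> L" "i \<le> L"
  shows "loop k B L 0 parse_step (enc_constraint (ts, xs)) ys s
    (s(0 := ys, 3 := enc_tokens (map (fill (contents i xs)) (tE ts (length xs))) @ s 3,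
       4 := enc_tokens (map (fill (contents i xs)) (tD ts (length xs))) @ s 4,
       5 := enc_tokens (map (fill (contents i xs)) (tV ts (length xs))) @ s 5,
       6 := replicate (cnt ts (length xs)) 1 @ s 6, 7 := replicate (Suc i) 1))" (is "loop _ _ _ _ _ _ _ _ ?f")
proof -
  let ?n = "length xs"
  have n: "?n \<le> K"
    using keys[OF key] by simp
  let ?s1 = "s(2 := rev (enc_list ts) @ s 2, 0 := [4] @ enc_list xs @ [5] @ ys)"
  have 1: "loop k B L 0 parse_step (enc_list ts) ([4] @ enc_list xs @ [5] @ ys) s ?s1"
  proof (rule loop_pushes)
    fix a and s' :: store
    assume a: "a \<in> set (enc_list ts)" "0 < a" "a < B" "s' 1 = s 1"
    then have "a \<noteq> 4"
      using set_enc_list[of ts] by auto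
    then show "exec k B L (parse_step a) s' (s'(2 := a # s' 2))"
      unfolding parse_step_def
      by (intro exec_Case) (use a s k B in \<open>auto intro!: exec_eq[OF exec_Push]\<close>)
  qed (use s0 in \<open>auto simp: enc_constraint_def\<close>)
  let ?s2 = "?s1(0 := [] @ enc_list xs @ [5] @ ys, 2 := 4 # rev (enc_list ts), 1 := [3 + 0])"
  have 2: "loop k B L 0 parse_step [4] (enc_list xs @ [5] @ ys) ?s1 ?s2"
    apply (rule loop_Cons[OF _ _ loop_Nil])
     apply (unfold parse_step_def)
     apply (rule exec_Case)
    using k apply simp
    using s apply simp
     apply (rule exec_eq)
      apply (rule exec_Seq, rule exec_Push)
         apply (use k B in simp_all)[3]
      apply (rule exec_Seq, rule exec_Pop)
       apply (use k in simp)
      apply (rule exec_Push)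
        apply (use k B in simp_all)[3]
     apply (use s in \<open>auto simp: fun_eq_iff\<close>)
    done
  let ?s3 = "\<lambda>r. if 20 + 0 \<le> r \<and> r < 20 + 0 + ?n then rev (enc_bits (xs ! (r - 20 - 0)))
    else (?s2(0 := [5] @ ys, 1 := [3 + 0 + ?n], 2 := replicate ?n 3 @ ?s2 2)) r"
  have 3: "loop k B L 0 parse_step (enc_list xs) ([5] @ ys) ?s2 ?s3"
    by (rule loop_variables) (use s n in auto)
  define t where "t = ?s3(0 := [] @ ys)"
  have "exec k B L (expand ts ?n) (t(1 := [2], 2 := []))
    (\<lambda>r. if 20 \<le> r \<and> r < 20 + ?n then [] else
    ((t(1 := [2], 2 := []))(3 := enc_tokens (map (fill (contents i xs)) (tE ts ?n)) @ (t(1 := [2], 2 := [])) 3,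
       4 := enc_tokens (map (fill (contents i xs)) (tD ts ?n)) @ (t(1 := [2], 2 := [])) 4,
       5 := enc_tokens (map (fill (contents i xs)) (tV ts ?n)) @ (t(1 := [2], 2 := [])) 5,
       6 := replicate (cnt ts ?n) 1 @ (t(1 := [2], 2 := [])) 6, 7 := 1 # (t(1 := [2], 2 := [])) 7)) r)"
    by (rule exec_expand[OF key]) (use s len in \<open>auto simp: t_def\<close>)
  then have ex: "exec k B L (expand ts ?n) (t(1 := [2], 2 := [])) ?f"
    by (rule exec_eq) (use s in \<open>auto simp: t_def fun_eq_iff\<close>)
  have t2: "(t(1 := [2])) 2 = key_word ts ?n"
    by (simp add: key_word_def t_def)
  have z: "0 \<notin> set (key_word ts ?n)"
    using set_enc_list[of ts] by (auto simp: key_word_def)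
  have "exec k B L (dispatch ([] @ (t(1 := [2])) 2)) (t(1 := [2], 2 := [])) ?f"
    using ex by (simp only: t2 append_Nil dispatch_key_word)
  then have rd: "exec k B L (read_word 2 n0 [] dispatch) (t(1 := [2])) ?f"
    by (rule exec_read_word[rotated 3]) (use k keys[OF key] z t2 in auto)
  have mode: "exec k B L (Pop 1 ;; Push 1 2 ;; read_word 2 n0 [] dispatch) t ?f"
    apply (rule exec_Seq, rule exec_Pop)
    using k apply simp
    apply (rule exec_Seq, rule exec_eq, rule exec_Push)
    using k apply simp
    using B apply simp
    using B apply simp
     prefer 2
     apply (rule rd)
    apply (auto simp: t_def fun_eq_iff)
    done
  have t1: "top_of (t 1) = 3 + ?n"
    by (simp add: t_def)
  have "exec k B L (parse_step 5) t ?f"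
    unfolding parse_step_def
    apply (rule exec_Case)
    using k apply simp
    apply (unfold t1)
    using mode by simp
  then have "loop k B L 0 parse_step [5] ys ?s3 ?f"
    unfolding t_def by (intro loop_Cons[OF _ _ loop_Nil]) auto
  with 3 have "loop k B L 0 parse_step (enc_list xs @ [5]) ys ?s2 ?f"
    by (rule loop_append)
  then have "loop k B L 0 parse_step ([4] @ enc_list xs @ [5]) ys ?s1 ?f"
    by (rule loop_append[rotated]) (use 2 in \<open>simp only: append_assoc\<close>)
  then have "loop k B L 0 parse_step (enc_list ts @ [4] @ enc_list xs @ [5]) ys s ?f"
    by (rule loop_append[rotated]) (use 1 in \<open>simp only: append_assoc\<close>)
  then show ?thesis
    by (simp only: enc_constraint_def fst_conv snd_conv append_assoc)
qed

definition total :: "constraint list \<Rightarrow> nat" where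
  "total cs = sum_list (map (\<lambda>(ts, xs). cnt ts (length xs)) cs)"

lemma loop_constraints:
  "\<lbrakk>\<forall>(ts, xs)\<in>set cs. (ts, length xs) \<in> keys \<and> (\<forall>x\<in>set xs. length x \<le> L); i + length cs \<le> L;
    s 1 = [2]; s 2 = []; s 7 = replicate i 1; s 8 = []; \<And>r. 20 \<le> r \<Longrightarrow> s r = [];
    s 0 = concat (map enc_constraint cs) @ ys\<rbrakk> \<Longrightarrow>
    loop k B L 0 parse_step (concat (map enc_constraint cs)) ys s
      (s(0 := ys, 3 := enc_tokens (expansion tE i cs) @ s 3, 4 := enc_tokens (expansion tD i cs) @ s 4,
         5 := enc_tokens (expansion tV i cs) @ s 5, 6 := replicate (total cs) 1 @ s 6,
         7 := replicate (i + length cs) 1))"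
proof (induction cs arbitrary: i s)
  case Nil
  show ?case
    unfolding list.map concat.simps
    by (rule loop_eq[OF loop_Nil]) (use Nil in \<open>auto simp: fun_eq_iff total_def\<close>)
next
  case (Cons c cs)
  obtain ts xs where c: "c = (ts, xs)"
    by (cases c)
  let ?ys = "concat (map enc_constraint cs) @ ys"
  let ?s = "s(0 := ?ys, 3 := enc_tokens (map (fill (contents i xs)) (tE ts (length xs))) @ s 3,
       4 := enc_tokens (map (fill (contents i xs)) (tD ts (length xs))) @ s 4,
       5 := enc_tokens (map (fill (contents i xs)) (tV ts (length xs))) @ s 5,
       6 := replicate (cnt ts (length xs)) 1 @ s 6, 7 := replicate (Suc i) 1)"
  have "loop k B L 0 parse_step (enc_constraint (ts, xs)) ?ys s ?s"
    by (rule loop_constraint) (use Cons.prems in \<open>auto simp: c\<close>)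
  moreover have "loop k B L 0 parse_step (concat (map enc_constraint cs)) ys ?s
      (?s(0 := ys, 3 := enc_tokens (expansion tE (Suc i) cs) @ ?s 3,
         4 := enc_tokens (expansion tD (Suc i) cs) @ ?s 4,
         5 := enc_tokens (expansion tV (Suc i) cs) @ ?s 5, 6 := replicate (total cs) 1 @ ?s 6,
         7 := replicate (Suc i + length cs) 1))"
    by (rule Cons.IH) (use Cons.prems in auto)
  ultimately have "loop k B L 0 parse_step (enc_constraint (ts, xs) @ concat (map enc_constraint cs)) ys s
      (?s(0 := ys, 3 := enc_tokens (expansion tE (Suc i) cs) @ ?s 3,
         4 := enc_tokens (expansion tD (Suc i) cs) @ ?s 4,
         5 := enc_tokens (expansion tV (Suc i) cs) @ ?s 5, 6 := replicate (total cs) 1 @ ?s 6,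
         7 := replicate (Suc i + length cs) 1))"
    by (rule loop_append)
  then show "loop k B L 0 parse_step (concat (map enc_constraint (c # cs))) ys s
      (s(0 := ys, 3 := enc_tokens (expansion tE i (c # cs)) @ s 3,
         4 := enc_tokens (expansion tD i (c # cs)) @ s 4,
         5 := enc_tokens (expansion tV i (c # cs)) @ s 5, 6 := replicate (total (c # cs)) 1 @ s 6,
         7 := replicate (i + length (c # cs)) 1))"
    unfolding c list.map concat.simps
    by (rule loop_eq) (auto simp: fun_eq_iff total_def replicate_add[symmetric] add.commute
        simp flip: append_assoc)
qed

lemma loop_header:
  "\<lbrakk>\<forall>v\<in>set V. length v \<le> L; s 1 = [1]; s 7 = []; s 8 = []; s 20 = []; s 0 = enc_list V @ ys\<rbrakk> \<Longrightarrow>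
    loop k B L 0 parse_step (enc_list V) ys s
      (s(0 := ys, 5 := enc_tokens (rev (map (\<lambda>v. Name (False # v)) V)) @ s 5))"
proof (induction V arbitrary: s)
  case Nil
  show ?case
    unfolding list.map enc_list_simps
    by (rule loop_eq[OF loop_Nil]) (use Nil in \<open>auto simp: fun_eq_iff\<close>)
next
  case (Cons v V)
  let ?s1 = "s(20 := rev (enc_bits v) @ s 20, 0 := [3] @ enc_list V @ ys)"
  have 1: "loop k B L 0 parse_step (enc_bits v) ([3] @ enc_list V @ ys) s ?s1"
  proof (rule loop_pushes)
    fix a and s' :: store
    assume a: "a \<in> set (enc_bits v)" "0 < a" "a < B" "s' 1 = s 1"
    then have "a < 3"
      using set_enc_bits[of v] by auto
    then show "exec k B L (parse_step a) s' (s'(20 := a # s' 20))"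
      unfolding parse_step_def
      by (intro exec_Case) (use a Cons.prems k B in \<open>auto intro!: exec_eq[OF exec_Push]\<close>)
  qed (use Cons.prems in auto)
  let ?t = "?s1(0 := [] @ enc_list V @ ys)"
  let ?s2 = "s(0 := enc_list V @ ys, 5 := enc_token (Name (False # v)) @ s 5)"
  have "exec k B L (emit 5 (Inl ([False], 20))) ?t
      (?t(5 := enc_token (fill (\<lambda>r. if r = 20 then v else []) (Inl ([False], 20))) @ ?t 5))"
    by (rule exec_emit[where P = "\<lambda>r. r = 20"]) (use Cons.prems k B in \<open>auto simp: enc_bits_def\<close>)
  then have "exec k B L (emit 5 (Inl ([False], 20)) ;; clear 20) ?t ?s2"
    apply -
    apply (rule exec_eq)
     apply (rule exec_Seq, assumption, rule exec_clear)
    using k apply simp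
    using Cons.prems apply simp
    using Cons.prems apply (auto simp: fun_eq_iff fill_def)
    done
  then have "exec k B L (parse_step 3) ?t ?s2"
    unfolding parse_step_def using Cons.prems k by (intro exec_Case) auto
  then have 2: "loop k B L 0 parse_step [3] (enc_list V @ ys) ?s1 ?s2"
    by (intro loop_Cons[OF _ _ loop_Nil]) auto
  have 3: "loop k B L 0 parse_step (enc_list V) ys ?s2
      (?s2(0 := ys, 5 := enc_tokens (rev (map (\<lambda>v. Name (False # v)) V)) @ ?s2 5))"
    by (rule Cons.IH) (use Cons.prems in auto)
  have "loop k B L 0 parse_step ([3] @ enc_list V) ys ?s1
      (?s2(0 := ys, 5 := enc_tokens (rev (map (\<lambda>v. Name (False # v)) V)) @ ?s2 5))"
    by (rule loop_append[OF 2 3])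
  then have "loop k B L 0 parse_step (enc_bits v @ [3] @ enc_list V) ys s
      (?s2(0 := ys, 5 := enc_tokens (rev (map (\<lambda>v. Name (False # v)) V)) @ ?s2 5))"
    by (rule loop_append[rotated]) (simp only: append_assoc 1)
  then show "loop k B L 0 parse_step (enc_list (v # V)) ys s
      (s(0 := ys, 5 := enc_tokens (rev (map (\<lambda>v. Name (False # v)) (v # V))) @ s 5))"
    unfolding enc_list_simps by (rule loop_eq) (auto simp: fun_eq_iff)
qed

text \<open>Pouring twice through register 8 preserves order. The stream in register 4 finally
  consists of equations, variables, the mark 5 and constraints. \<open>Pop 1\<close> leaves the mode
  register empty, as each \<open>subst_pass\<close> expects.\<close>

definition program :: com where
  "program = Push 1 1 ;; For 0 parse_step ;; Pop 1 ;; Push 4 5 ;;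
    pour 5 8 ;; pour 8 4 ;; pour 3 8 ;; pour 8 4 ;;
    For 6 (\<lambda>_. subst_pass) ;; For 4 (\<lambda>a. Push (k - 1) (unshift a))"

lemma exec_output:
  assumes "length (s 4) \<le> L"
  shows "exec k B L (For 4 (\<lambda>a. Push (k - 1) (unshift a))) s
    (s(k - 1 := rev (map unshift (s 4)) @ s (k - 1), 4 := []))"
  using assms k
  by (intro exec_For_prefix[where
        S = "\<lambda>us. s(k - 1 := rev (map unshift us) @ s (k - 1), 4 := drop (length us) (s 4))"])
    (auto simp: unshift_def intro!: exec_eq[OF exec_Push])

lemma exec_parse:
  assumes cs: "\<forall>(ts, xs)\<in>set cs. (ts, length xs) \<in> keys \<and> (\<forall>x\<in>set xs. length x \<le> L)"
    and V: "\<forall>v\<in>set V. length v \<le> L"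
    and len: "length cs \<le> L" "length (enc_inst (V, cs)) \<le> L"
  shows "exec k B L (For 0 parse_step) ((\<lambda>_. [])(0 := enc_inst (V, cs), 1 := [1]))
    ((\<lambda>_. [])(1 := [2], 3 := enc_tokens (expansion tE 0 cs), 4 := enc_tokens (expansion tD 0 cs),
      5 := enc_tokens (expansion tV 0 cs @ rev (map (\<lambda>v. Name (False # v)) V)),
      6 := replicate (total cs) 1, 7 := replicate (length cs) 1))" (is "exec _ _ _ _ ?s ?t")
proof -
  let ?cs = "concat (map enc_constraint cs)"
  let ?s1 = "?s(0 := [5] @ ?cs, 5 := enc_tokens (rev (map (\<lambda>v. Name (False # v)) V)) @ ?s 5)"
  have 1: "loop k B L 0 parse_step (enc_list V) ([5] @ ?cs) ?s ?s1"
    by (rule loop_header) (use V in \<open>auto simp: enc_inst_def\<close>)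
  let ?s2 = "?s1(0 := ?cs, 1 := [2])"
  have 2: "loop k B L 0 parse_step [5] (?cs @ []) ?s1 ?s2"
    apply (rule loop_Cons[OF _ _ loop_Nil])
     apply (unfold parse_step_def)
     apply (rule exec_Case)
    using k apply simp
     apply simp
     apply (rule exec_eq)
      apply (rule exec_Seq, rule exec_Pop)
    using k apply simp
      apply (rule exec_Push)
    using k B by (auto simp: fun_eq_iff)
  have 3: "loop k B L 0 parse_step ?cs [] ?s2
      (?s2(0 := [], 3 := enc_tokens (expansion tE 0 cs) @ ?s2 3, 4 := enc_tokens (expansion tD 0 cs) @ ?s2 4,
         5 := enc_tokens (expansion tV 0 cs) @ ?s2 5, 6 := replicate (total cs) 1 @ ?s2 6,
         7 := replicate (0 + length cs) 1))"
    by (rule loop_constraints) (use cs len in auto)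
  have "loop k B L 0 parse_step ([5] @ ?cs) [] ?s1 ?t"
    by (rule loop_eq, rule loop_append[OF 2 3]) (auto simp: fun_eq_iff)
  then have "loop k B L 0 parse_step (enc_list V @ [5] @ ?cs) [] ?s ?t"
    by (rule loop_append[rotated]) (simp only: append_assoc append_Nil2 1)
  then show ?thesis
    using len k by (intro exec_For_loop) (simp_all add: enc_inst_def)
qed

end

section \<open>Eliminating equations\<close>

lemma eliminate_ok:
  "\<forall>t\<in>set ts. token_ok B A t \<Longrightarrow>
    (\<forall>t\<in>set (eliminate n ts). token_ok B A t) \<and> length (eliminate n ts) \<le> length ts"
proof (induction n arbitrary: ts)
  case (Suc n)
  show ?case
  proof (cases "\<exists>u v ts'. ts = Name u # Name v # ts'")
    case True
    then obtain u v ts' where ts: "ts = Name u # Name v # ts'"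
      by blast
    have "\<forall>t\<in>set (map (rename (replace u v)) ts'). token_ok B A t"
      using Suc.prems token_ok_replace by (auto simp: ts)
    from Suc.IH[OF this] show ?thesis
      by (simp add: ts)
  next
    case False
    then have "eliminate (Suc n) ts = ts"
      by (auto split: list.split token.split)
    then show ?thesis
      using Suc.prems by simp
  qed
qed simp

definition satisfies :: "(bool list \<Rightarrow> 'a) \<Rightarrow> (bool list \<times> bool list) list \<Rightarrow> bool" where
  "satisfies \<sigma> E \<longleftrightarrow> (\<forall>e\<in>set E. \<sigma> (fst e) = \<sigma> (snd e))"

text \<open>
  The second condition says that \<open>\<rho>\<close> identifies no more names than the equations force.
\<close>

definition merges :: "(bool list \<times> bool list) list \<Rightarrow> (bool list \<Rightarrow> bool list) \<Rightarrow> bool" where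
  "merges E \<rho> \<longleftrightarrow> satisfies \<rho> E \<and>
    (\<forall>\<sigma> :: bool list \<Rightarrow> bool. satisfies \<sigma> E \<longrightarrow> (\<forall>x. \<sigma> (\<rho> x) = \<sigma> x))"

lemma satisfies_map: "satisfies \<sigma> (map (map_prod r r) E) \<longleftrightarrow> satisfies (\<sigma> \<circ> r) E"
  by (simp add: satisfies_def)

text \<open>An assignment with equal values at \<open>u\<close> and \<open>v\<close> is unchanged by
  composition with \<open>replace u v\<close>, hence it also solves the renamed equations and the
  assumption applies to it.\<close>

lemma merges_Cons:
  assumes "merges (map (map_prod (replace u v) (replace u v)) E) \<rho>"
  shows "merges ((u, v) # E) (\<rho> \<circ> replace u v)"
  unfolding merges_def
proof (intro conjI allI impI)
  show "satisfies (\<rho> \<circ> replace u v) ((u, v) # E)"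
    using assms by (auto simp: merges_def satisfies_map) (auto simp: satisfies_def replace_def)
next
  fix \<sigma> :: "bool list \<Rightarrow> bool" and x
  assume \<sigma>: "satisfies \<sigma> ((u, v) # E)"
  then have r: "\<sigma> (replace u v y) = \<sigma> y" for y
    by (simp add: satisfies_def replace_def)
  then have "\<sigma> \<circ> replace u v = \<sigma>"
    by auto
  then have "satisfies \<sigma> (map (map_prod (replace u v) (replace u v)) E)"
    using \<sigma> by (simp add: satisfies_map) (simp add: satisfies_def)
  then show "\<sigma> ((\<rho> \<circ> replace u v) x) = \<sigma> x"
    using assms r unfolding merges_def comp_apply by metis
qed

text \<open>The renaming depends on the equations alone: one \<open>\<rho>\<close> works for every
  remaining stream \<open>ts\<close>.\<close>

lemma eliminate_pair_tokens:
  "\<exists>\<rho>. merges E \<rho> \<and> (\<forall>ts. eliminate (length E) (pair_tokens E @ ts) = map (rename \<rho>) ts)"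
proof (induction "length E" arbitrary: E)
  case 0
  have "rename (\<lambda>x. x) t = t" for t
    by (cases t) auto
  then have "map (rename (\<lambda>x. x)) ts = ts" for ts
    by (simp add: map_idI)
  then show ?case
    using 0 by (intro exI[of _ "\<lambda>x. x"]) (auto simp: merges_def satisfies_def)
next
  case (Suc n)
  then obtain u v E' where E: "E = (u, v) # E'" and n: "n = length E'"
    by (cases E) auto
  let ?r = "replace u v"
  let ?E = "map (map_prod ?r ?r) E'"
  have "n = length ?E"
    using n by simp
  from Suc.hyps(1)[OF this] obtain \<rho> where \<rho>: "merges ?E \<rho>"
    and elim: "\<forall>ts. eliminate (length ?E) (pair_tokens ?E @ ts) = map (rename \<rho>) ts"
    by blast
  have comp: "rename \<rho> (rename ?r t) = rename (\<rho> \<circ> ?r) t" for t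
    by (cases t) auto
  have "eliminate (length E) (pair_tokens E @ ts) = map (rename (\<rho> \<circ> ?r)) ts" for ts
    using elim[rule_format, of "map (rename ?r) ts"] by (simp add: E map_rename_pair_tokens comp)
  then show ?case
    using merges_Cons[OF \<rho>] E by blast
qed

context expander
begin

lemma exec_program:
  assumes cs: "\<forall>(ts, xs)\<in>set cs. (ts, length xs) \<in> keys \<and> (\<forall>x\<in>set xs. length x \<le> L)"
    and V: "\<forall>v\<in>set V. length v \<le> L"
    and len: "length cs \<le> L" "length (enc_inst (V, cs)) \<le> L"
    and E: "expansion tE 0 cs = pair_tokens E" "total cs = length E"
    and toks: "toks = expansion tV 0 cs @ rev (map (\<lambda>v. Name (False # v)) V) @ Mark 5 # expansion tD 0 cs"
    and ok: "\<forall>t\<in>set (pair_tokens E @ toks). token_ok B A t"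
    and L: "A < L" "length (pair_tokens E @ toks) * Suc A \<le> L"
  shows "\<exists>s. exec k B L program ((\<lambda>_. [])(0 := enc_inst (V, cs))) s \<and>
    s (k - 1) = rev (map unshift (enc_tokens (eliminate (length E) (pair_tokens E @ toks))))"
proof -
  \<comment> \<open>The stacks poured after parsing consist of tokens of the full stream, so one
    estimate covers them all.\<close>
  have bound: "length (enc_tokens ts) \<le> L"
    if "set ts \<subseteq> set (pair_tokens E @ toks)" "length ts \<le> length (pair_tokens E @ toks)" for ts
  proof -
    have "length (enc_tokens ts) \<le> length ts * Suc A"
      by (rule length_enc_tokens_le[of ts B]) (use ok that in blast)
    also have "\<dots> \<le> length (pair_tokens E @ toks) * Suc A"
      by (rule mult_right_mono) (use that in auto)
    finally show ?thesis
      using L by simp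
  qed
  let ?VT = "expansion tV 0 cs @ rev (map (\<lambda>v. Name (False # v)) V)"
  let ?DT = "Mark 5 # expansion tD 0 cs"
  have b5: "length (enc_tokens ?VT) \<le> L"
    by (rule bound) (auto simp: toks)
  have b3: "length (enc_tokens (pair_tokens E)) \<le> L"
    by (rule bound) auto
  have "length E \<le> length (pair_tokens E)"
    by (induction E) auto
  also have "\<dots> \<le> length (pair_tokens E @ toks) * Suc A"
    by simp
  finally have b6: "length E \<le> L"
    using L by simp
  let ?final = "eliminate (length E) (pair_tokens E @ toks)"
  have "length (enc_tokens ?final) \<le> length ?final * Suc A"
    by (rule length_enc_tokens_le[of _ B]) (use eliminate_ok[OF ok] in blast)
  also have "\<dots> \<le> length (pair_tokens E @ toks) * Suc A"
    by (rule mult_right_mono) (use eliminate_ok[OF ok] in auto)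
  finally have b4: "length (enc_tokens ?final) \<le> L"
    using L by simp
  let ?s = "(\<lambda>_ :: nat. [])(0 := enc_inst (V, cs))"
  let ?t = "(\<lambda>_ :: nat. [])(1 := [2], 3 := enc_tokens (expansion tE 0 cs), 4 := enc_tokens (expansion tD 0 cs),
      5 := enc_tokens ?VT, 6 := replicate (total cs) 1, 7 := replicate (length cs) 1)"
  let ?u = "(\<lambda>_ :: nat. [])(4 := enc_tokens (pair_tokens E @ toks), 6 := replicate (length E) 1,
      7 := replicate (length cs) 1)"
  have push: "exec k B L (Push 1 1) ?s (?s(1 := [1]))"
    by (rule exec_eq, rule exec_Push) (use k B in auto)
  have parse: "exec k B L (For 0 parse_step) (?s(1 := [1])) ?t"
    by (rule exec_parse[OF cs V len])
  have "loop k B L 6 (\<lambda>_. subst_pass) (replicate (length E) 1) [] ?u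
      (?u(4 := enc_tokens ?final, 6 := []))"
    by (rule loop_subst[where A = A]) (use k B L ok in auto)
  then have subst: "exec k B L (For 6 (\<lambda>_. subst_pass)) ?u (?u(4 := enc_tokens ?final, 6 := []))"
    using k b6 by (intro exec_For_loop) auto
  let ?v = "?u(4 := enc_tokens ?final, 6 := [])"
  have out: "exec k B L (For 4 (\<lambda>a. Push (k - 1) (unshift a))) ?v
    (?v(k - 1 := rev (map unshift (?v 4)) @ ?v (k - 1), 4 := []))"
    by (rule exec_output) (use b4 in simp)
  have "exec k B L program ?s (?v(k - 1 := rev (map unshift (?v 4)) @ ?v (k - 1), 4 := []))"
    unfolding program_def
    apply (rule exec_Seq, rule push)
    apply (rule exec_Seq, rule parse)
    apply (rule exec_Seq, rule exec_Pop)
    using k apply simp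
    apply (rule exec_Seq, rule exec_Push)
       apply (use k B in simp_all)[3]
    apply (rule exec_Seq, rule exec_pour)
        apply (use k b5 in simp_all)[4]
    apply (rule exec_Seq, rule exec_pour)
        apply (use k b5 in simp_all)[4]
    apply (rule exec_Seq, rule exec_pour)
        apply (use k b3 in \<open>simp_all add: E\<close>)[4]
    apply (rule exec_Seq, rule exec_eq, rule exec_pour)
         apply (use k b3 in \<open>simp_all add: E\<close>)[4]
     prefer 2
     apply (rule exec_Seq, rule subst)
     apply (rule out)
    apply (auto simp: fun_eq_iff E toks)
    done
  then show ?thesis
    apply (intro exI conjI)
     apply assumption
    using k by simp
qed

end

section \<open>Correctness of the replacement\<close>

text \<open>
  Names in the new instance: \<open>x\<^sub>i\<close> is the old variable with a prefix, and \<open>y\<^sub>l\<close> in the definition used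
  for constraint \<open>j\<close> is coded by \<open>l\<close> and \<open>j\<close> in unary.
\<close>

definition name :: "nat \<Rightarrow> var list \<Rightarrow> nat \<Rightarrow> bool list" where
  "name j xs i = (if i < length xs then False # xs ! i
    else True # replicate (i - length xs) False @ True # replicate j False)"

text \<open>Counterpart of \<open>expansion\<close> on the level of names and constraints, in the
  same reversed order, so that the two agree as lists.\<close>

fun spread :: "(nat \<Rightarrow> bool list list \<Rightarrow> var list \<Rightarrow> 'a list) \<Rightarrow> nat \<Rightarrow> constraint list \<Rightarrow> 'a list" where
  "spread g i [] = []"
| "spread g i ((ts, xs) # cs) = spread g (Suc i) cs @ g i ts xs"

lemma set_spread:
  "set (spread g i cs) = (\<Union>j<length cs. set (g (i + j) (fst (cs ! j)) (snd (cs ! j))))"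
proof (induction g i cs rule: spread.induct)
  case (2 g i ts xs cs)
  have "{..<length ((ts, xs) # cs)} = insert 0 (Suc ` {..<length cs})"
    by (simp add: lessThan_Suc_eq_insert_0)
  then show ?case
    using 2 by (simp add: Un_commute)
qed simp

definition tuples :: "brel \<Rightarrow> bool list list" where
  "tuples S = (SOME ts. distinct ts \<and> set ts = snd S)"

lemma tuples: "is_brel S \<Longrightarrow> distinct (tuples S) \<and> set (tuples S) = snd S"
proof -
  assume "is_brel S"
  then have "snd S \<subseteq> {l. set l \<subseteq> UNIV \<and> length l = arity S}"
    by (auto simp: is_brel_def)
  then have "finite (snd S)"
    by (rule finite_subset) (rule finite_lists_length_eq, simp)
  then have "\<exists>ts. distinct ts \<and> set ts = snd S"
    using finite_distinct_list by blast
  then show ?thesis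
    unfolding tuples_def by (rule someI_ex)
qed

definition eq_atoms :: "atom list \<Rightarrow> atom list" where
  "eq_atoms \<phi> = filter (\<lambda>a. fst a = Eq_rel) \<phi>"

definition rel_atoms :: "atom list \<Rightarrow> atom list" where
  "rel_atoms \<phi> = filter (\<lambda>a. fst a \<noteq> Eq_rel) \<phi>"

definition solutions :: "inst \<Rightarrow> (var \<Rightarrow> bool) set" where
  "solutions I = {\<sigma> \<in> set (fst I) \<rightarrow>\<^sub>E UNIV. \<forall>(ts, xs)\<in>set (snd I). map \<sigma> xs \<in> set ts}"

lemma ex1_mem_iff_card: "(\<exists>!x. x \<in> A) \<longleftrightarrow> card A = 1"
proof
  assume "\<exists>!x. x \<in> A"
  then obtain x where "x \<in> A" "\<forall>y. y \<in> A \<longrightarrow> y = x"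
    by (rule ex1E)
  then have "A = {x}"
    by blast
  then show "card A = 1"
    by simp
next
  assume "card A = 1"
  then obtain x where "A = {x}"
    by (rule card_1_singletonE)
  then show "\<exists>!x. x \<in> A"
    by simp
qed

text \<open>Unique satisfiability as a cardinality, so that a bijection between solution sets is
  enough.\<close>

lemma uniquely_satisfiable_iff: "uniquely_satisfiable I \<longleftrightarrow> card (solutions I) = 1"
  unfolding ex1_mem_iff_card[symmetric]
  by (simp only: uniquely_satisfiable_def solutions_def mem_Collect_eq)

locale reduction =
  fixes \<Gamma> \<Delta> :: "brel set" and m :: "brel \<Rightarrow> nat" and \<phi> :: "brel \<Rightarrow> atom list"
  assumes brel_\<Gamma>: "\<And>S. S \<in> \<Gamma> \<Longrightarrow> is_brel S"
    and upp: "\<And>R. R \<in> \<Delta> \<Longrightarrow> upp_definition \<Gamma> R (m R) (\<phi> R)"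
begin

definition eq_pairs :: "nat \<Rightarrow> bool list list \<Rightarrow> var list \<Rightarrow> (bool list \<times> bool list) list" where
  "eq_pairs j ts xs =
    map (\<lambda>(S, is). (name j xs (is ! 0), name j xs (is ! 1))) (eq_atoms (\<phi> (length xs, set ts)))"

definition new_constraints :: "nat \<Rightarrow> bool list list \<Rightarrow> var list \<Rightarrow> constraint list" where
  "new_constraints j ts xs =
    map (\<lambda>(S, is). (tuples S, map (name j xs) is)) (rel_atoms (\<phi> (length xs, set ts)))"

definition new_vars :: "nat \<Rightarrow> bool list list \<Rightarrow> var list \<Rightarrow> var list" where
  "new_vars j ts xs = map (\<lambda>l. name j xs (length xs + l)) [0..<m (length xs, set ts)]"

definition all_vars :: "inst \<Rightarrow> var list" where
  "all_vars I = spread new_vars 0 (snd I) @ rev (map ((#) False) (fst I))"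

definition reduct :: "(bool list \<Rightarrow> bool list) \<Rightarrow> inst \<Rightarrow> inst" where
  "reduct \<rho> I = (map \<rho> (all_vars I), map (map_prod id (map \<rho>)) (spread new_constraints 0 (snd I)))"

end

text \<open>Correctness is shown for every \<open>\<rho>\<close> with the abstract property
  \<open>merges\<close>, which separates it from the algorithm that computes
  \<open>\<rho>\<close>.\<close>

locale reduced_instance = reduction +
  fixes V :: "var list" and cs :: "constraint list" and \<rho> :: "bool list \<Rightarrow> bool list"
  assumes inst: "is_instance \<Delta> (V, cs)"
    and merges: "merges (spread eq_pairs 0 cs) \<rho>"
begin

abbreviation tuples_at :: "nat \<Rightarrow> bool list list" where "tuples_at j \<equiv> fst (cs ! j)"
abbreviation vars_at :: "nat \<Rightarrow> var list" where "vars_at j \<equiv> snd (cs ! j)"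
abbreviation rel_at :: "nat \<Rightarrow> brel" where "rel_at j \<equiv> (length (vars_at j), set (tuples_at j))"
abbreviation name_at :: "nat \<Rightarrow> nat \<Rightarrow> bool list" where "name_at j \<equiv> name j (vars_at j)"

lemma constraint_at:
  assumes "j < length cs"
  shows "rel_at j \<in> \<Delta>" "set (vars_at j) \<subseteq> set V"
proof -
  have "cs ! j \<in> set cs"
    using assms by simp
  then show "rel_at j \<in> \<Delta>" "set (vars_at j) \<subseteq> set V"
    using inst by (simp_all add: is_instance_def split_beta)
qed

lemmas upp_at = upp[OF constraint_at(1), unfolded upp_definition_def Let_def fst_conv snd_conv]

lemma atom_at:
  assumes "j < length cs" "(S, is) \<in> set (\<phi> (rel_at j))"
  shows "S \<in> \<Gamma> \<union> {Eq_rel}" "length is = arity S" "set is \<subseteq> {..<length (vars_at j) + m (rel_at j)}"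
  using bspec[OF conjunct1[OF upp_at[OF assms(1)]] assms(2)] by simp_all

lemma tuples_at:
  assumes "j < length cs"
  shows "set (tuples_at j) = {map s [0..<length (vars_at j)] |s. sat s (\<phi> (rel_at j))}"
  by (rule conjunct1[OF conjunct2[OF upp_at[OF assms]]])

lemma functional_at:
  assumes "j < length cs" "l < m (rel_at j)" "sat s (\<phi> (rel_at j))" "sat s' (\<phi> (rel_at j))"
    and "map s [0..<length (vars_at j)] = map s' [0..<length (vars_at j)]"
  shows "s (length (vars_at j) + l) = s' (length (vars_at j) + l)"
proof -
  obtain f :: "bool list \<Rightarrow> bool" where f: "\<forall>s. sat s (\<phi> (rel_at j)) \<longrightarrow>
      s (length (vars_at j) + l) = f (map s [0..<length (vars_at j)])"
    using conjunct2[OF conjunct2[OF upp_at[OF assms(1)]], rule_format, OF assms(2)] by (rule exE)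
  show ?thesis
    using f[rule_format, OF assms(3)] f[rule_format, OF assms(4)] assms(5) by (simp only:)
qed

lemma set_all_vars: "set (all_vars (V, cs)) = Cons False ` set V \<union>
    (\<Union>j<length cs. (\<lambda>l. name_at j (length (vars_at j) + l)) ` {..<m (rel_at j)})"
  by (auto simp: all_vars_def set_spread new_vars_def)

lemma name_at_in_all_vars:
  assumes "j < length cs" "i < length (vars_at j) + m (rel_at j)"
  shows "name_at j i \<in> set (all_vars (V, cs))"
proof (cases "i < length (vars_at j)")
  case True
  then have "vars_at j ! i \<in> set V"
    using constraint_at(2)[OF assms(1)] by auto
  then show ?thesis
    using True by (simp add: set_all_vars name_def)
next
  case False
  then have "name_at j i \<in> (\<lambda>l. name_at j (length (vars_at j) + l)) ` {..<m (rel_at j)}"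
    using assms(2) by (intro image_eqI[of _ _ "i - length (vars_at j)"]) simp_all
  then show ?thesis
    unfolding set_all_vars by (intro UnI2 UN_I[of j]) (use assms(1) in simp)
qed

lemma eq_pair_at:
  assumes "j < length cs" "(Eq_rel, is) \<in> set (\<phi> (rel_at j))"
  shows "(name_at j (is ! 0), name_at j (is ! 1)) \<in> set (spread eq_pairs 0 cs)"
proof -
  have "(Eq_rel, is) \<in> set (eq_atoms (\<phi> (rel_at j)))"
    using assms by (simp add: eq_atoms_def)
  then have "(name_at j (is ! 0), name_at j (is ! 1)) \<in> set (eq_pairs (0 + j) (tuples_at j) (vars_at j))"
    unfolding eq_pairs_def set_map by (rule image_eqI[rotated]) simp
  then show ?thesis
    unfolding set_spread by (rule UN_I[rotated]) (use assms(1) in simp)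
qed

lemma set_reduct: "set (snd (reduct \<rho> (V, cs))) = (\<Union>j<length cs.
    (\<lambda>a. (tuples (fst a), map (\<lambda>i. \<rho> (name_at j i)) (snd a))) ` set (rel_atoms (\<phi> (rel_at j))))"
  by (simp add: reduct_def set_spread new_constraints_def image_UN image_image split_beta comp_def)

lemma reduct_constraints:
  "(ts, ns) \<in> set (snd (reduct \<rho> (V, cs))) \<longleftrightarrow>
    (\<exists>j S is. j < length cs \<and> (S, is) \<in> set (\<phi> (rel_at j)) \<and> S \<noteq> Eq_rel \<and> ts = tuples S \<and>
      ns = map (\<lambda>i. \<rho> (name_at j i)) is)" (is "?L \<longleftrightarrow> ?R")
proof
  assume ?L
  then obtain j where j: "j \<in> {..<length cs}" and ts: "(ts, ns) \<in>
      (\<lambda>a. (tuples (fst a), map (\<lambda>i. \<rho> (name_at j i)) (snd a))) ` set (rel_atoms (\<phi> (rel_at j)))"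
    unfolding set_reduct by (rule UN_E)
  from ts obtain a where a: "(ts, ns) = (tuples (fst a), map (\<lambda>i. \<rho> (name_at j i)) (snd a))"
    "a \<in> set (rel_atoms (\<phi> (rel_at j)))"
    by (rule imageE)
  have "(fst a, snd a) \<in> set (\<phi> (rel_at j))" "fst a \<noteq> Eq_rel"
    using a(2) by (simp_all add: rel_atoms_def)
  moreover have "ts = tuples (fst a)" "ns = map (\<lambda>i. \<rho> (name_at j i)) (snd a)"
    using a(1) by (simp_all only: prod.inject)
  ultimately show ?R
    using j[unfolded lessThan_iff] by (intro exI conjI)
next
  assume ?R
  then obtain j S "is" where j: "j < length cs" "(S, is) \<in> set (\<phi> (rel_at j))" "S \<noteq> Eq_rel"
    and eq: "ts = tuples S" "ns = map (\<lambda>i. \<rho> (name_at j i)) is"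
    by (elim exE conjE)
  have "(S, is) \<in> set (rel_atoms (\<phi> (rel_at j)))"
    using j by (simp add: rel_atoms_def)
  then have "(ts, ns) \<in> (\<lambda>a. (tuples (fst a), map (\<lambda>i. \<rho> (name_at j i)) (snd a))) `
      set (rel_atoms (\<phi> (rel_at j)))"
    by (rule image_eqI[rotated]) (simp add: eq)
  then show ?L
    unfolding set_reduct by (rule UN_I[rotated]) (use j in simp)
qed

lemma is_instance_reduct: "is_instance \<Gamma> (reduct \<rho> (V, cs))"
  unfolding is_instance_def
proof (intro ballI, clarify)
  fix ts ns
  assume "(ts, ns) \<in> set (snd (reduct \<rho> (V, cs)))"
  then obtain j S "is" where j: "j < length cs" "(S, is) \<in> set (\<phi> (rel_at j))" "S \<noteq> Eq_rel"
    "ts = tuples S" "ns = map (\<lambda>i. \<rho> (name_at j i)) is"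
    unfolding reduct_constraints by blast
  note a = atom_at[OF j(1,2)]
  then have "S \<in> \<Gamma>"
    using j(3) by simp
  then have "distinct ts" "(length ns, set ts) \<in> \<Gamma>"
    using tuples[OF brel_\<Gamma>, of S] a(2) j(4,5) by simp_all
  moreover have "set ns \<subseteq> set (fst (reduct \<rho> (V, cs)))"
    using a(3) j(5) name_at_in_all_vars[OF j(1)] by (auto simp: reduct_def)
  ultimately show "distinct ts \<and> (length ns, set ts) \<in> \<Gamma> \<and> set ns \<subseteq> set (fst (reduct \<rho> (V, cs)))"
    by blast
qed

text \<open>Equality atoms hold because \<open>\<rho>\<close> gives both arguments the same name;
  all other atoms are constraints of the new instance.\<close>

lemma sat_reduct:
  assumes \<tau>: "\<tau> \<in> solutions (reduct \<rho> (V, cs))" and j: "j < length cs"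
  shows "sat (\<lambda>i. \<tau> (\<rho> (name_at j i))) (\<phi> (rel_at j))"
  unfolding sat_def
proof (intro ballI, clarify)
  fix n T "is"
  assume a: "((n, T), is) \<in> set (\<phi> (rel_at j))"
  show "map (\<lambda>i. \<tau> (\<rho> (name_at j i))) is \<in> snd (n, T)"
  proof (cases "(n, T) = Eq_rel")
    case True
    then have "length is = 2"
      using atom_at(2)[OF j a] by (simp add: Eq_rel_def)
    then obtain i i' where is_eq: "is = [i, i']"
      by (auto simp: length_Suc_conv numeral_2_eq_2)
    have "\<rho> (name_at j i) = \<rho> (name_at j i')"
      using merges eq_pair_at[OF j, of "is"] a True unfolding merges_def satisfies_def
      by (fastforce simp: is_eq)
    then show ?thesis
      unfolding True by (simp add: Eq_rel_def is_eq)
  next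
    case False
    then have "(n, T) \<in> \<Gamma>"
      using atom_at(1)[OF j a] by simp
    then have "set (tuples (n, T)) = T"
      using tuples[OF brel_\<Gamma>] by simp
    moreover have "(tuples (n, T), map (\<lambda>i. \<rho> (name_at j i)) is) \<in> set (snd (reduct \<rho> (V, cs)))"
      unfolding reduct_constraints using j a False by blast
    then have "map \<tau> (map (\<lambda>i. \<rho> (name_at j i)) is) \<in> set (tuples (n, T))"
      using \<tau> unfolding solutions_def by blast
    ultimately show ?thesis
      by (simp add: comp_def)
  qed
qed

definition restore :: "(var \<Rightarrow> bool) \<Rightarrow> var \<Rightarrow> bool" where
  "restore \<tau> = restrict (\<lambda>v. \<tau> (\<rho> (False # v))) (set V)"

lemma map_restore:
  assumes "j < length cs"
  shows "map (restore \<tau>) (vars_at j) = map (\<lambda>i. \<tau> (\<rho> (name_at j i))) [0..<length (vars_at j)]"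
  using constraint_at(2)[OF assms]
  by (intro nth_equalityI) (auto simp: restore_def name_def subset_iff)

lemma restore_solution:
  assumes "\<tau> \<in> solutions (reduct \<rho> (V, cs))"
  shows "restore \<tau> \<in> solutions (V, cs)"
proof -
  have "map (restore \<tau>) xs \<in> set ts" if "(ts, xs) \<in> set cs" for ts xs
  proof -
    obtain j where j: "j < length cs" "cs ! j = (ts, xs)"
      using \<open>(ts, xs) \<in> set cs\<close> by (meson in_set_conv_nth)
    show ?thesis
      using tuples_at[OF j(1)] sat_reduct[OF assms j(1)] map_restore[OF j(1), of \<tau>] j(2)
      by auto
  qed
  then show ?thesis
    by (auto simp: solutions_def restore_def)
qed

text \<open>Here functional dependence enters: the old variables of a constraint determine the
  values of its fresh ones.\<close>

lemma inj_on_restore: "inj_on restore (solutions (reduct \<rho> (V, cs)))"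
proof (rule inj_onI)
  fix \<tau> \<tau>'
  assume \<tau>: "\<tau> \<in> solutions (reduct \<rho> (V, cs))" and \<tau>': "\<tau>' \<in> solutions (reduct \<rho> (V, cs))"
    and eq: "restore \<tau> = restore \<tau>'"
  have "\<tau> (\<rho> x) = \<tau>' (\<rho> x)" if "x \<in> set (all_vars (V, cs))" for x
  proof -
    consider v where "v \<in> set V" "x = False # v"
      | j l where "j < length cs" "l < m (rel_at j)" "x = name_at j (length (vars_at j) + l)"
      using \<open>x \<in> set (all_vars (V, cs))\<close> unfolding set_all_vars by blast
    then show ?thesis
    proof cases
      case 1
      then show ?thesis
        using fun_cong[OF eq, of v] by (simp add: restore_def)
    next
      case 2
      show ?thesis
        using functional_at[OF 2(1,2) sat_reduct[OF \<tau> 2(1)] sat_reduct[OF \<tau>' 2(1)]]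
          map_restore[OF 2(1), of \<tau>] map_restore[OF 2(1), of \<tau>'] eq 2(3) by simp
    qed
  qed
  moreover have "\<tau> \<in> \<rho> ` set (all_vars (V, cs)) \<rightarrow>\<^sub>E UNIV" "\<tau>' \<in> \<rho> ` set (all_vars (V, cs)) \<rightarrow>\<^sub>E UNIV"
    using \<tau> \<tau>' by (simp_all add: solutions_def reduct_def)
  ultimately show "\<tau> = \<tau>'"
    by (intro PiE_ext) auto
qed

text \<open>Witnesses are chosen for each constraint separately. As fresh names of different
  constraints differ, the choices combine into one assignment \<open>\<pi>\<close> of all names,
  which solves the equations and therefore passes to the renamed variables.\<close>

lemma restore_surj:
  assumes \<sigma>: "\<sigma> \<in> solutions (V, cs)"
  shows "\<exists>\<tau>\<in>solutions (reduct \<rho> (V, cs)). restore \<tau> = \<sigma>"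
proof -
  have ex: "\<exists>s. sat s (\<phi> (rel_at j)) \<and> map s [0..<length (vars_at j)] = map \<sigma> (vars_at j)"
    if "j < length cs" for j
  proof -
    have "(tuples_at j, vars_at j) \<in> set cs"
      using that by simp
    then have "map \<sigma> (vars_at j) \<in> set (tuples_at j)"
      using \<sigma> unfolding solutions_def by auto
    then have "map \<sigma> (vars_at j) \<in> {map s [0..<length (vars_at j)] |s. sat s (\<phi> (rel_at j))}"
      by (rule equalityD1[OF tuples_at[OF that], THEN subsetD])
    then show ?thesis
      by (elim CollectE exE conjE) (simp only: exI conjI)
  qed
  define s where "s j = (SOME s. sat s (\<phi> (rel_at j)) \<and>
    map s [0..<length (vars_at j)] = map \<sigma> (vars_at j))" for j
  have s: "sat (s j) (\<phi> (rel_at j))"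
    and s_eq: "map (s j) [0..<length (vars_at j)] = map \<sigma> (vars_at j)" if "j < length cs" for j
    using someI_ex[OF ex[OF that], folded s_def] by (rule conjunct1, rule conjunct2)
  \<comment> \<open>Inverts \<open>name\<close>: after a leading \<open>True\<close>, the bits up to
    the next \<open>True\<close> give the index \<open>l\<close> of the fresh variable, the
    remaining ones the constraint \<open>j\<close>.\<close>
  define \<pi> where "\<pi> x = (case x of [] \<Rightarrow> False | b # y \<Rightarrow> if b then
    (let l = length (takeWhile Not y); j = length y - l - 1 in s j (length (vars_at j) + l)) else \<sigma> y)" for x
  have \<pi>_name: "\<pi> (name_at j i) = s j i" if "j < length cs" for i j
  proof (cases "i < length (vars_at j)")
    case True
    then have "s j i = \<sigma> (vars_at j ! i)"
      using arg_cong[OF s_eq[OF that], of "\<lambda>l. l ! i"] by simp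
    then show ?thesis
      using True by (simp add: \<pi>_def name_def)
  next
    case False
    have "takeWhile Not (replicate l False @ True # replicate j False) = replicate l False" for l
      by (induction l) auto
    then show ?thesis
      using False by (simp add: \<pi>_def name_def Let_def)
  qed
  have "satisfies \<pi> (spread eq_pairs 0 cs)"
    unfolding satisfies_def
  proof
    fix e
    assume "e \<in> set (spread eq_pairs 0 cs)"
    then obtain j where "j \<in> {..<length cs}" and e: "e \<in> set (eq_pairs (0 + j) (tuples_at j) (vars_at j))"
      unfolding set_spread by (rule UN_E)
    from e obtain a where "a \<in> set (eq_atoms (\<phi> (rel_at j)))"
      "e = (name_at j (snd a ! 0), name_at j (snd a ! 1))"
      unfolding eq_pairs_def set_map split_beta add_0 by (elim imageE)
    with \<open>j \<in> _\<close> obtain "is" where j: "j < length cs" "(Eq_rel, is) \<in> set (\<phi> (rel_at j))"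
      "e = (name_at j (is ! 0), name_at j (is ! 1))"
      by (cases a) (simp add: eq_atoms_def)
    have "length is = 2"
      using atom_at(2)[OF j(1,2)] by (simp add: Eq_rel_def)
    then obtain i i' where is_eq: "is = [i, i']"
      by (auto simp: length_Suc_conv numeral_2_eq_2)
    have "map (s j) is \<in> snd Eq_rel"
      using bspec[OF s[OF j(1), unfolded sat_def] j(2)] by simp
    then show "\<pi> (fst e) = \<pi> (snd e)"
      using j by (simp add: is_eq \<pi>_name Eq_rel_def)
  qed
  \<comment> \<open>This is the second half of \<open>merges\<close>: \<open>\<rho>\<close>
    identifies no names that \<open>\<pi>\<close> distinguishes.\<close>
  then have \<pi>\<rho>: "\<pi> (\<rho> x) = \<pi> x" for x
    using merges by (simp add: merges_def)
  define \<tau> where "\<tau> = restrict \<pi> (\<rho> ` set (all_vars (V, cs)))"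
  have \<tau>\<rho>: "\<tau> (\<rho> x) = \<pi> x" if "x \<in> set (all_vars (V, cs))" for x
    using that by (simp add: \<tau>_def \<pi>\<rho>)
  have constraints: "map \<tau> ns \<in> set ts" if "(ts, ns) \<in> set (snd (reduct \<rho> (V, cs)))" for ts ns
  proof -
    obtain j S "is" where j: "j < length cs" "(S, is) \<in> set (\<phi> (rel_at j))" "S \<noteq> Eq_rel"
      "ts = tuples S" "ns = map (\<lambda>i. \<rho> (name_at j i)) is"
      using \<open>(ts, ns) \<in> _\<close> unfolding reduct_constraints by blast
    have "S \<in> \<Gamma>"
      using atom_at(1)[OF j(1,2)] j(3) by simp
    have "\<tau> (\<rho> (name_at j i)) = s j i" if "i \<in> set is" for i
      using \<tau>\<rho>[OF name_at_in_all_vars[OF j(1)]] atom_at(3)[OF j(1,2)] that \<pi>_name[OF j(1)]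
      by (auto simp: subset_iff)
    then have "map \<tau> ns = map (s j) is"
      by (simp add: j(5))
    also have "\<dots> \<in> snd S"
      using bspec[OF s[OF j(1), unfolded sat_def] j(2)] by simp
    finally show ?thesis
      using tuples[OF brel_\<Gamma>[OF \<open>S \<in> \<Gamma>\<close>]] j(4) by simp
  qed
  have "\<tau> \<in> set (fst (reduct \<rho> (V, cs))) \<rightarrow>\<^sub>E UNIV"
    unfolding \<tau>_def reduct_def fst_conv set_map by simp
  then have "\<tau> \<in> solutions (reduct \<rho> (V, cs))"
    unfolding solutions_def mem_Collect_eq split_beta
    using constraints by (metis (no_types, lifting) prod.collapse)
  moreover have "restore \<tau> = \<sigma>"
  proof
    fix v
    show "restore \<tau> v = \<sigma> v"
    proof (cases "v \<in> set V")
      case True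
      then have "\<tau> (\<rho> (False # v)) = \<sigma> v"
        by (subst \<tau>\<rho>) (simp_all add: set_all_vars \<pi>_def)
      then show ?thesis
        using True by (simp add: restore_def)
    next
      case False
      then show ?thesis
        using \<sigma> by (auto simp: restore_def solutions_def PiE_def extensional_def)
    qed
  qed
  ultimately show ?thesis
    by blast
qed

lemma uniquely_satisfiable_reduct:
  "uniquely_satisfiable (reduct \<rho> (V, cs)) \<longleftrightarrow> uniquely_satisfiable (V, cs)"
proof -
  have "bij_betw restore (solutions (reduct \<rho> (V, cs))) (solutions (V, cs))"
    unfolding bij_betw_def using inj_on_restore restore_solution restore_surj by blast
  then show ?thesis
    unfolding uniquely_satisfiable_iff by (simp add: bij_betw_same_card)
qed

end

lemma enc_constraints_inject:
  "concat (map enc_constraint cs) = concat (map enc_constraint cs') \<Longrightarrow> cs = cs'"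
proof (induction cs arbitrary: cs')
  case Nil
  then show ?case
    by (cases cs') (auto simp: enc_constraint_def)
next
  case (Cons c cs)
  then obtain c' cs'' where cs': "cs' = c' # cs''"
    by (cases cs') (auto simp: enc_constraint_def)
  have "fst c = fst c' \<and> enc_list (snd c) @ 5 # concat (map enc_constraint cs) =
      enc_list (snd c') @ 5 # concat (map enc_constraint cs'')"
    using enc_list_inject[of "fst c" 4 "enc_list (snd c) @ 5 # concat (map enc_constraint cs)"
        "fst c'" 4 "enc_list (snd c') @ 5 # concat (map enc_constraint cs'')"] Cons.prems
    by (simp add: cs' enc_constraint_def[of c] enc_constraint_def[of c'])
  moreover from this have "snd c = snd c' \<and> concat (map enc_constraint cs) = concat (map enc_constraint cs'')"
    using enc_list_inject[of "snd c" 5 "concat (map enc_constraint cs)" "snd c'" 5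
        "concat (map enc_constraint cs'')"] by simp
  ultimately show ?case
    using Cons.IH[of cs''] by (simp add: cs' prod_eq_iff)
qed

text \<open>Permits the reduction to be defined on words through \<open>inv enc_inst\<close>, and
  membership of a code in the set of yes-instances to be read off the instance.\<close>

lemma inj_enc_inst: "inj enc_inst"
proof (rule injI)
  fix I I'
  assume "enc_inst I = enc_inst I'"
  then have "fst I = fst I' \<and> concat (map enc_constraint (snd I)) = concat (map enc_constraint (snd I'))"
    using enc_list_inject[of "fst I" 5 "concat (map enc_constraint (snd I))"
        "fst I'" 5 "concat (map enc_constraint (snd I'))"] by (simp add: enc_inst_def)
  then show "I = I'"
    using enc_constraints_inject by (simp add: prod_eq_iff)
qed

section \<open>The reduction as a program\<close>

text \<open>This is \<open>name\<close> with the constraint index left open: the trailing unary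
  \<open>j\<close> is supplied by register 7, as a template only has a fixed prefix.\<close>

definition var_template :: "nat \<Rightarrow> nat \<Rightarrow> token_template" where
  "var_template n i = (if i < n then Inl ([False], 20 + i)
    else Inl (True # replicate (i - n) False @ [True], 7))"

lemma fill_var_template: "fill (contents j xs) (var_template (length xs) i) = Name (name j xs i)"
  by (simp add: fill_def contents_def var_template_def name_def)

definition constraint_tokens :: "constraint list \<Rightarrow> token list" where
  "constraint_tokens C = concat (map (\<lambda>c. map (\<lambda>b. Mark (b + 10)) (enc_list (fst c) @ [4]) @
    map Name (snd c) @ [Mark 5]) C)"

fun prefix_length :: "token_template \<Rightarrow> nat" where
  "prefix_length (Inl (p, r)) = length p"
| "prefix_length (Inr a) = 0"

lemma enc_tokens_Name: "enc_tokens (map Name xs) = enc_list xs"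
  by (induction xs) auto

text \<open>The tuples are untouched because their symbols occur as marks.\<close>

lemma map_rename_constraint_tokens:
  "map (rename \<rho>) (constraint_tokens C) = constraint_tokens (map (map_prod id (map \<rho>)) C)"
  by (induction C) (auto simp: constraint_tokens_def)

lemma map_unshift_id: "set w \<subseteq> {1, 2, 3} \<Longrightarrow> map unshift w = w"
  by (induction w) (auto simp: unshift_def)

lemma map_unshift_enc_list: "map unshift (enc_list xs) = enc_list xs"
  by (rule map_unshift_id[OF set_enc_list])

lemma map_unshift_shift: "0 \<notin> set w \<Longrightarrow> map unshift (enc_tokens (map (\<lambda>b. Mark (b + 10)) w)) = w"
  by (induction w) (auto simp: unshift_def)

lemma unshift_constraint_tokens:
  "map unshift (enc_tokens (constraint_tokens C)) = concat (map enc_constraint C)"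
proof (induction C)
  case (Cons c C)
  have "0 \<notin> set (enc_list (fst c) @ [4])"
    using set_enc_list[of "fst c"] by auto
  from map_unshift_shift[OF this] show ?case
    using Cons
    by (simp add: constraint_tokens_def enc_constraint_def enc_tokens_Name map_unshift_enc_list)
      (simp add: unshift_def)
qed (simp add: constraint_tokens_def)

lemma unshift_instance_tokens:
  "map unshift (enc_tokens (map (rename \<rho>) (map Name U @ Mark 5 # constraint_tokens C))) =
    enc_inst (map \<rho> U, map (map_prod id (map \<rho>)) C)"
proof -
  have "map (rename \<rho>) (map Name U) = map Name (map \<rho> U)"
    by simp
  then have "map (rename \<rho>) (map Name U @ Mark 5 # constraint_tokens C) =
      map Name (map \<rho> U) @ Mark 5 # constraint_tokens (map (map_prod id (map \<rho>)) C)"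
    by (simp only: map_append list.map rename.simps map_rename_constraint_tokens)
  then show ?thesis
    by (simp only: enc_tokens_simps enc_tokens_Name map_append map_unshift_enc_list
        unshift_constraint_tokens enc_inst_def fst_conv snd_conv enc_token.simps list.map append_Cons append_Nil)
      (simp add: unshift_def)
qed

lemma length_expansion:
  assumes "\<And>ts n. (ts, n) \<in> keys \<Longrightarrow> length (f ts n) \<le> H"
  shows "\<forall>(ts, xs)\<in>set cs. (ts, length xs) \<in> keys \<Longrightarrow> length (expansion f i cs) \<le> length cs * H"
proof (induction cs arbitrary: i)
  case (Cons c cs)
  obtain ts xs where c: "c = (ts, xs)"
    by (cases c)
  show ?case
    using Cons.IH[of "Suc i"] Cons.prems assms[of ts "length xs"] by (simp add: c)
qed simp

text \<open>A name is a prefix of length at most \<open>H\<close> followed by an old variable or the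
  counter, both of length at most \<open>N\<close>.\<close>

lemma token_ok_expansion:
  assumes f: "\<And>ts n t. \<lbrakk>(ts, n) \<in> keys; t \<in> set (f ts n)\<rbrakk> \<Longrightarrow>
      template_ok k B (\<lambda>r. r < 20 + n) t \<and> prefix_length t \<le> H"
  shows "\<lbrakk>\<forall>(ts, xs)\<in>set cs. (ts, length xs) \<in> keys \<and> (\<forall>x\<in>set xs. length x \<le> N); i + length cs \<le> N;
    t \<in> set (expansion f i cs)\<rbrakk> \<Longrightarrow> token_ok B (H + N) t"
proof (induction cs arbitrary: i)
  case (Cons c cs)
  obtain ts xs where c: "c = (ts, xs)"
    by (cases c)
  have key: "(ts, length xs) \<in> keys" and len: "\<And>x. x \<in> set xs \<Longrightarrow> length x \<le> N" and i: "i \<le> N"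
    using Cons.prems by (auto simp: c)
  have "token_ok B (H + N) (fill (contents i xs) u)" if "u \<in> set (f ts (length xs))" for u
  proof (cases u)
    case (Inr a)
    then show ?thesis
      using f[OF key that] by (simp add: fill_def)
  next
    case (Inl pr)
    then obtain p r where u: "u = Inl (p, r)"
      by (cases pr) auto
    have "length p \<le> H" "r = 7 \<or> 20 \<le> r \<and> r < 20 + length xs"
      using f[OF key that] by (auto simp: u)
    moreover from this(2) have "length (contents i xs r) \<le> N"
      using i len[of "xs ! (r - 20)"] by (auto simp: contents_def)
    ultimately show ?thesis
      by (simp add: u fill_def)
  qed
  then show ?case
    using Cons.IH[of "Suc i"] Cons.prems by (auto simp: c)
qed simp

lemma length_le_enc_list: "v \<in> set V \<Longrightarrow> length v \<le> length (enc_list V)"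
  by (induction V) auto

lemma length_enc_list_ge: "length V \<le> length (enc_list V)"
  by (induction V) auto

lemma length_enc_constraints_ge: "length cs \<le> length (concat (map enc_constraint cs))"
  by (induction cs) (auto simp: enc_constraint_def)

lemma set_enc_inst: "set (enc_inst I) \<subseteq> {1..5}"
proof -
  have l: "set (enc_list xs) \<subseteq> {1..5}" for xs
    using set_enc_list[of xs] by auto
  then have "set (enc_constraint c) \<subseteq> {1..5}" for c
    by (simp add: enc_constraint_def)
  then have "set (concat (map enc_constraint cs)) \<subseteq> {1..5}" for cs
    by (simp add: UN_subset_iff)
  then show ?thesis
    using l by (simp add: enc_inst_def)
qed

context reduction
begin

definition tE :: templates where
  "tE ts n = concat (map (\<lambda>a. map (var_template n) (snd a)) (eq_atoms (\<phi> (n, set ts))))"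

definition tD :: templates where
  "tD ts n = concat (map (\<lambda>a. map (\<lambda>b. Inr (b + 10)) (enc_list (tuples (fst a)) @ [4]) @
    map (var_template n) (snd a) @ [Inr 5]) (rel_atoms (\<phi> (n, set ts))))"

definition tV :: templates where
  "tV ts n = map (\<lambda>l. var_template n (n + l)) [0..<m (n, set ts)]"

definition cnt :: "bool list list \<Rightarrow> nat \<Rightarrow> nat" where
  "cnt ts n = length (eq_atoms (\<phi> (n, set ts)))"

definition keys :: "(bool list list \<times> nat) set" where
  "keys = {(ts, n). distinct ts \<and> (n, set ts) \<in> \<Delta>}"

lemma fill_tE:
  assumes "(length xs, set ts) \<in> \<Delta>"
  shows "map (fill (contents j xs)) (tE ts (length xs)) = pair_tokens (eq_pairs j ts xs)"
proof -
  have len: "length (snd a) = 2" if "a \<in> set (eq_atoms (\<phi> (length xs, set ts)))" for a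
  proof -
    have "a \<in> set (\<phi> (length xs, set ts))" "fst a = Eq_rel"
      using that by (simp_all add: eq_atoms_def)
    then show ?thesis
      using bspec[OF conjunct1[OF upp[OF assms, unfolded upp_definition_def Let_def]], of a]
      by (simp add: split_beta Eq_rel_def)
  qed
  have "map (fill (contents j xs)) (concat (map (\<lambda>a. map (var_template (length xs)) (snd a)) as)) =
      pair_tokens (map (\<lambda>(S, is). (name j xs (is ! 0), name j xs (is ! 1))) as)"
    if "\<forall>a\<in>set as. length (snd a) = 2" for as :: "atom list"
    using that
  proof (induction as)
    case (Cons a as)
    then obtain i i' where "snd a = [i, i']"
      by (auto simp: length_Suc_conv numeral_2_eq_2)
    then show ?case
      using Cons by (simp add: split_beta fill_var_template)
  qed simp
  then show ?thesis
    using len by (simp add: tE_def eq_pairs_def)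
qed

lemma fill_tV: "map (fill (contents j xs)) (tV ts (length xs)) = map Name (new_vars j ts xs)"
  by (simp add: tV_def new_vars_def fill_var_template)

lemma fill_tD:
  "map (fill (contents j xs)) (tD ts (length xs)) = constraint_tokens (new_constraints j ts xs)"
  by (simp add: tD_def new_constraints_def constraint_tokens_def map_concat comp_def split_beta
      fill_var_template) (simp add: fill_def)

lemma expansion_eq:
  assumes "\<forall>(ts, xs)\<in>set cs. (length xs, set ts) \<in> \<Delta>"
  shows "expansion tE i cs = pair_tokens (spread eq_pairs i cs)"
    "expansion tV i cs = map Name (spread new_vars i cs)"
    "expansion tD i cs = constraint_tokens (spread new_constraints i cs)"
    "sum_list (map (\<lambda>(ts, xs). cnt ts (length xs)) cs) = length (spread eq_pairs i cs)"
proof -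
  have "expansion tE i cs = pair_tokens (spread eq_pairs i cs) \<and>
    expansion tV i cs = map Name (spread new_vars i cs) \<and>
    expansion tD i cs = constraint_tokens (spread new_constraints i cs) \<and>
    sum_list (map (\<lambda>(ts, xs). cnt ts (length xs)) cs) = length (spread eq_pairs i cs)"
    using assms
  proof (induction cs arbitrary: i)
    case Nil
    then show ?case by (simp add: constraint_tokens_def)
  next
    case (Cons c cs)
    obtain ts xs where c: "c = (ts, xs)"
      by (cases c)
    have "pair_tokens (E @ E') = pair_tokens E @ pair_tokens E'"
      "constraint_tokens (C @ C') = constraint_tokens C @ constraint_tokens C'" for E E' C C'
      by (simp_all add: pair_tokens_def constraint_tokens_def)
    moreover have "cnt ts (length xs) = length (eq_pairs i ts xs)"
      by (simp add: cnt_def eq_pairs_def)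
    ultimately show ?case
      using Cons.IH[of "Suc i"] Cons.prems fill_tE[of xs ts i] fill_tV[of i xs ts] fill_tD[of i xs ts]
      by (simp add: c)
  qed
  then show "expansion tE i cs = pair_tokens (spread eq_pairs i cs)"
    "expansion tV i cs = map Name (spread new_vars i cs)"
    "expansion tD i cs = constraint_tokens (spread new_constraints i cs)"
    "sum_list (map (\<lambda>(ts, xs). cnt ts (length xs)) cs) = length (spread eq_pairs i cs)"
    by simp_all
qed

lemma template_ok_keys:
  assumes "n \<le> K" "t \<in> set (tE ts n) \<union> set (tD ts n) \<union> set (tV ts n)"
  shows "template_ok (22 + K) (25 + K) (\<lambda>r. r < 20 + n) t"
proof -
  have v: "template_ok (22 + K) (25 + K) (\<lambda>r. r < 20 + n) (var_template n i)" for i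
    using assms(1) by (simp add: var_template_def)
  have "b < 15 + K" if "b \<in> set (enc_list xs)" for b xs
    using that set_enc_list[of xs] by auto
  then show ?thesis
    using assms(2) v by (fastforce simp: tE_def tD_def tV_def split: if_splits)
qed

text \<open>Fixes by choice a renaming realised by the elimination, so that the reduction is a
  function of the instance.\<close>

definition merger :: "constraint list \<Rightarrow> bool list \<Rightarrow> bool list" where
  "merger cs = (SOME \<rho>. merges (spread eq_pairs 0 cs) \<rho> \<and>
    (\<forall>ts. eliminate (length (spread eq_pairs 0 cs)) (pair_tokens (spread eq_pairs 0 cs) @ ts) =
      map (rename \<rho>) ts))"

lemma merger:
  "merges (spread eq_pairs 0 cs) (merger cs)"
  "eliminate (length (spread eq_pairs 0 cs)) (pair_tokens (spread eq_pairs 0 cs) @ ts) =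
    map (rename (merger cs)) ts"
proof -
  note * = someI_ex[OF eliminate_pair_tokens[of "spread eq_pairs 0 cs"], folded merger_def]
  show "merges (spread eq_pairs 0 cs) (merger cs)"
    by (rule conjunct1[OF *])
  show "eliminate (length (spread eq_pairs 0 cs)) (pair_tokens (spread eq_pairs 0 cs) @ ts) =
      map (rename (merger cs)) ts"
    by (rule spec[OF conjunct2[OF *]])
qed

text \<open>An instance may list a relation in any order but without repetitions, which leaves
  finitely many lists for each relation.\<close>

lemma finite_keys:
  assumes "finite \<Delta>"
  shows "finite keys"
proof -
  have "keys \<subseteq> (\<Union>R\<in>\<Delta>. {ts. set ts = snd R \<and> distinct ts} \<times> {fst R})"
    by (auto simp: keys_def)
  moreover have "finite {ts. set ts = T \<and> distinct ts}" for T :: "bool list set"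
  proof (cases "finite T")
    case True
    show ?thesis
      by (rule finite_subset[OF _ finite_subset_distinct[OF True]]) auto
  next
    case False
    then have "{ts. set ts = T \<and> distinct ts} = {}"
      by auto
    then show ?thesis
      by (simp only: finite.emptyI)
  qed
  ultimately show ?thesis
    using assms by (elim finite_subset) (auto intro!: finite_cartesian_product)
qed

lemma poly_time_reduct:
  assumes "finite \<Delta>"
  shows "poly_time_on (enc_inst ` {I. is_instance \<Delta> I})
    (\<lambda>w. let I = inv enc_inst w in enc_inst (reduct (merger (snd I)) I))"
proof -
  \<comment> \<open>Adds up everything that needs a bound, so that finiteness of \<open>keys\<close>
    yields one constant \<open>H\<close> for arities, key lengths, templates and prefixes.\<close>
  define size where "size a = (case a of (ts, n) \<Rightarrow> n + length (key_word ts n) + length (tE ts n) +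
    length (tD ts n) + length (tV ts n) +
    sum_list (map prefix_length (tE ts n @ tD ts n @ tV ts n)))" for a
  have "finite (size ` keys)"
    using finite_keys[OF assms] by (rule finite_imageI)
  then obtain H where "\<forall>x\<in>size ` keys. x \<le> H"
    unfolding finite_nat_set_iff_bounded_le by (rule exE)
  then have size: "size (ts, n) \<le> H" if "(ts, n) \<in> keys" for ts n
    using that by blast
  have H: "n \<le> H" "length (key_word ts n) \<le> H" "length (tE ts n) \<le> H" "length (tD ts n) \<le> H"
    "length (tV ts n) \<le> H" if "(ts, n) \<in> keys" for ts n
    using size[OF that] by (simp_all add: size_def)
  have prefix: "prefix_length t \<le> H" if "(ts, n) \<in> keys" "t \<in> set (tE ts n @ tD ts n @ tV ts n)" for ts n t
  proof -
    have "prefix_length t \<le> sum_list (map prefix_length (tE ts n @ tD ts n @ tV ts n))"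
      by (rule member_le_sum_list) (use that in auto)
    then show ?thesis
      using size[OF that(1)] unfolding size_def prod.case by linarith
  qed
  interpret expander H H "22 + H" "25 + H" tE tD tV cnt keys
    by standard (use H template_ok_keys in auto)
  \<comment> \<open>The first factor bounds the number of tokens: three templates of at most
    \<open>H\<close> tokens per constraint, one name per variable, and the mark 5. The second is
    \<open>Suc (H + N + 1)\<close>, the maximal length of an encoded token.\<close>
  define q :: "nat poly" where "q = [:1, 3 * H + 1:] * [:H + 2, 1:]"
  show ?thesis
  proof (rule poly_time_on_program[of "22 + H" "25 + H" _ q program])
    fix w
    assume "w \<in> enc_inst ` {I. is_instance \<Delta> I}"
    then obtain V cs where w: "w = enc_inst (V, cs)" and inst: "is_instance \<Delta> (V, cs)"
      by auto
    define N where "N = length w"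
    define L where "L = poly q N"
    define E where "E = spread eq_pairs 0 cs"
    have L: "L = (1 + N * (3 * H + 1)) * (H + 2 + N)"
      by (simp add: L_def q_def algebra_simps)
    have "H + 2 + N \<le> L"
      unfolding L by simp
    then have NL: "N \<le> L" and AL: "H + N + 1 < L"
      by simp_all
    have \<Delta>: "\<forall>(ts, xs)\<in>set cs. (length xs, set ts) \<in> \<Delta>"
      and keys: "\<forall>(ts, xs)\<in>set cs. (ts, length xs) \<in> keys"
      and sub: "\<forall>(ts, xs)\<in>set cs. set xs \<subseteq> set V"
      using inst by (auto simp: is_instance_def keys_def)
    have V: "length v \<le> N" if "v \<in> set V" for v
      using length_le_enc_list[OF that] by (simp add: N_def w enc_inst_def)
    have lenV: "length V \<le> N" and lencs: "length cs \<le> N"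
      using length_enc_list_ge[of V] length_enc_constraints_ge[of cs]
      by (simp_all add: N_def w enc_inst_def)
    have cs: "\<forall>(ts, xs)\<in>set cs. (ts, length xs) \<in> keys \<and> (\<forall>x\<in>set xs. length x \<le> N)"
      using keys sub V by fast
    note exp = expansion_eq[OF \<Delta>, of 0, folded E_def]
    define toks where
      "toks = expansion tV 0 cs @ rev (map (\<lambda>v. Name (False # v)) V) @ Mark 5 # expansion tD 0 cs"
    have toks_eq: "toks = map Name (all_vars (V, cs)) @ Mark 5 # constraint_tokens (spread new_constraints 0 cs)"
      unfolding toks_def exp all_vars_def by (simp add: rev_map comp_def)
    have tok: "token_ok (25 + H) (H + N) t"
      if "t \<in> set (expansion tE 0 cs) \<union> set (expansion tV 0 cs) \<union> set (expansion tD 0 cs)" for t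
    proof -
      have *: "token_ok (25 + H) (H + N) t" if f: "f \<in> {tE, tV, tD}" and t: "t \<in> set (expansion f 0 cs)" for f
      proof (rule token_ok_expansion[OF _ cs _ t])
        fix ts n u
        assume "(ts, n) \<in> keys" "u \<in> set (f ts n)"
        then show "template_ok (22 + H) (25 + H) (\<lambda>r. r < 20 + n) u \<and> prefix_length u \<le> H"
          using f H(1) by (auto intro!: template_ok_keys prefix[of ts n])
      qed (use lencs in simp)
      show ?thesis
        using \<open>t \<in> _\<close> *[of tE] *[of tV] *[of tD] by blast
    qed
    \<comment> \<open>The additional 1 is for the bit \<open>False\<close> put in front of each old
      variable in the list of variables.\<close>
    have mono: "token_ok (25 + H) (H + N + 1) t" if "token_ok (25 + H) (H + N) t" for t
      using that by (cases t) auto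
    have ok: "\<forall>t\<in>set (pair_tokens E @ toks). token_ok (25 + H) (H + N + 1) t"
    proof
      fix t
      assume "t \<in> set (pair_tokens E @ toks)"
      then consider "t \<in> set (expansion tE 0 cs) \<union> set (expansion tV 0 cs) \<union> set (expansion tD 0 cs)"
        | v where "v \<in> set V" "t = Name (False # v)" | "t = Mark 5"
        unfolding toks_def exp(1)[symmetric] by auto
      then show "token_ok (25 + H) (H + N + 1) t"
      proof cases
        case 1
        then show ?thesis
          by (rule mono[OF tok])
      next
        case 2
        then show ?thesis
          using V[of v] by simp
      qed simp
    qed
    have "length (expansion f 0 cs) \<le> N * H" if "f \<in> {tE, tV, tD}" for f
    proof -
      have "length (expansion f 0 cs) \<le> length cs * H"
        by (rule length_expansion[OF _ keys]) (use that H in auto)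
      also have "\<dots> \<le> N * H"
        using lencs by simp
      finally show ?thesis .
    qed
    from this[of tE] this[of tV] this[of tD]
    have "length (pair_tokens E @ toks) \<le> 1 + N * (3 * H + 1)"
      unfolding toks_def exp(1)[symmetric] using lenV by (simp add: algebra_simps)
    then have "length (pair_tokens E @ toks) * Suc (H + N + 1) \<le> (1 + N * (3 * H + 1)) * (H + 2 + N)"
      by (intro mult_mono) simp_all
    then have len: "length (pair_tokens E @ toks) * Suc (H + N + 1) \<le> L"
      unfolding L .
    have "\<exists>s. exec (22 + H) (25 + H) L program ((\<lambda>_. [])(0 := enc_inst (V, cs))) s \<and>
        s (22 + H - 1) = rev (map unshift (enc_tokens (eliminate (length E) (pair_tokens E @ toks))))"
    proof (rule exec_program[OF _ _ _ _ exp(1) _ toks_def ok AL len])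
      show "\<forall>(ts, xs)\<in>set cs. (ts, length xs) \<in> keys \<and> (\<forall>x\<in>set xs. length x \<le> L)"
        using cs NL le_trans by fast
      show "\<forall>v\<in>set V. length v \<le> L"
        using V NL le_trans by blast
      show "length cs \<le> L" "length (enc_inst (V, cs)) \<le> L"
        using lencs NL by (simp_all add: N_def w)
      show "total cs = length E"
        unfolding total_def by (rule exp(4))
    qed
    moreover have "map unshift (enc_tokens (eliminate (length E) (pair_tokens E @ toks))) =
        enc_inst (reduct (merger cs) (V, cs))"
      unfolding E_def merger(2) toks_eq unshift_instance_tokens reduct_def by simp
    moreover have "inv enc_inst w = (V, cs)"
      unfolding w by (rule inv_f_f[OF inj_enc_inst])
    ultimately have "wp (22 + H) (25 + H) (poly q (length w)) program
        (\<lambda>s. s (22 + H - 1) = rev (let I = inv enc_inst w in enc_inst (reduct (merger (snd I)) I)))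
        ((\<lambda>_. [])(0 := w))"
      unfolding exec_def by (auto simp: w[symmetric] L_def N_def)
    moreover have "set w \<subseteq> {0<..<25 + H}"
      using set_enc_inst[of "(V, cs)"] by (auto simp: w)
    ultimately show "set w \<subseteq> {0<..<25 + H} \<and> wp (22 + H) (25 + H) (poly q (length w)) program
        (\<lambda>s. s (22 + H - 1) = rev (let I = inv enc_inst w in enc_inst (reduct (merger (snd I)) I)))
        ((\<lambda>_. [])(0 := w))"
      by blast
  qed simp_all
qed

end

theorem theorem27:
  fixes \<Gamma> \<Delta> :: "brel set"
  assumes "\<forall>R\<in>\<Gamma>. is_brel R" and "\<forall>R\<in>\<Delta>. is_brel R"
    and "represented \<Gamma>" and "represented \<Delta>"
    and "finite \<Delta>"
    and "\<Delta> \<subseteq> upp_closure \<Gamma>"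
  shows "USAT \<Delta> \<le>\<^sub>p USAT \<Gamma>"
proof -
  \<comment> \<open>One definition per relation is fixed in advance and becomes part of the program
    text.\<close>
  have "\<forall>R. \<exists>p. R \<in> \<Delta> \<longrightarrow> upp_definition \<Gamma> R (fst p) (snd p)"
    using assms(6) by (force simp: upp_closure_def)
  from choice[OF this] obtain p
    where p: "\<forall>R. R \<in> \<Delta> \<longrightarrow> upp_definition \<Gamma> R (fst (p R)) (snd (p R))"
    by (rule exE)
  interpret reduction \<Gamma> \<Delta> "\<lambda>R. fst (p R)" "\<lambda>R. snd (p R)"
    by standard (use assms(1) p in auto)
  define f where "f = (\<lambda>w. let I = inv enc_inst w in enc_inst (reduct (merger (snd I)) I))"
  have f: "f (enc_inst I) = enc_inst (reduct (merger (snd I)) I)" for I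
    by (simp add: f_def inv_f_f[OF inj_enc_inst])
  have "poly_time_on (instances (USAT \<Delta>)) f"
    using poly_time_reduct[OF assms(5)] by (simp add: USAT_def f_def)
  moreover have "f w \<in> instances (USAT \<Gamma>) \<and> (w \<in> yes (USAT \<Delta>) \<longleftrightarrow> f w \<in> yes (USAT \<Gamma>))"
    if w_inst: "w \<in> instances (USAT \<Delta>)" for w
  proof -
    obtain V cs where w: "w = enc_inst (V, cs)" and inst: "is_instance \<Delta> (V, cs)"
      using w_inst by (auto simp: USAT_def)
    interpret reduced_instance \<Gamma> \<Delta> "\<lambda>R. fst (p R)" "\<lambda>R. snd (p R)" V cs "merger cs"
      by standard (rule inst, rule merger(1))
    show ?thesis
      using inst is_instance_reduct uniquely_satisfiable_reduct
      by (simp add: USAT_def w f inj_image_mem_iff[OF inj_enc_inst])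
  qed
  ultimately show ?thesis
    unfolding poly_reducible_def by blast
qed

end
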